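(* Let $\theta\in(0,2\pi)$. Then for all $x,y\in S_\theta$: (1) $j^*_{S_\theta}(x,y)\le p_{S_\theta}(x,y)\le\sqrt2\, j^*_{S_\theta}(x,y)$ for every $\theta\in(0,2\pi)$; (2) $j^*_{S_\theta}(x,y)\le s_{S_\theta}(x,y)\le\sqrt2\, j^*_{S_\theta}(x,y)$ if $\theta\in(0,\pi]$; (3) $j^*_{S_\theta}(x,y)\le s_{S_\theta}(x,y)\le 2\sin(\theta/4)\, j^*_{S_\theta}(x,y)$ if $\theta\in(\pi,2\pi)$; (4) $(\sqrt2\cos(\theta/4))^{-1}p_{S_\theta}(x,y)\le s_{S_\theta}(x,y)\le p_{S_\theta}(x,y)$ if $\theta\in(0,\pi]$; (5) $p_{S_\theta}(x,y)\le s_{S_\theta}(x,y)\le \sqrt2\sin(\theta/4)\, p_{S_\theta}(x,y)$ if $\theta\in(\pi,2\pi)$. Furthermore, the constants are sharp (best possible) in each case.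
   Context: For $\theta\in(0,2\pi)$, $S_\theta=\{x\in\mathbb{C}:0<\arg(x)<\theta\}$. For a domain $G\subsetneq\mathbb{C}$ and $x\in G$, $d_G(x)=\inf\{|x-z|: z\in\partial G\}$. Define $s_G(x,y)=\frac{|x-y|}{\inf_{z\in\partial G}(|x-z|+|z-y|)}$ (triangular ratio metric), $j^*_G(x,y)=\frac{|x-y|}{|x-y|+2\min\{d_G(x),d_G(y)\}}$, and $p_G(x,y)=\frac{|x-y|}{\sqrt{|x-y|^2+4d_G(x)d_G(y)}}$ (point pair function). *)

theory Defs
  imports "HOL-Analysis.Analysis"
begin

definition sector :: "real \<Rightarrow> complex set" where
  "sector \<theta> = {z. z \<noteq> 0 \<and> 0 < Arg2pi z \<and> Arg2pi z < \<theta>}"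

definition bdist :: "complex set \<Rightarrow> complex \<Rightarrow> real" where
  "bdist G x = infdist x (frontier G)"

definition s_metric :: "complex set \<Rightarrow> complex \<Rightarrow> complex \<Rightarrow> real" where
  "s_metric G x y = dist x y / (INF z\<in>frontier G. dist x z + dist z y)"

definition j_star :: "complex set \<Rightarrow> complex \<Rightarrow> complex \<Rightarrow> real" where
  "j_star G x y = dist x y / (dist x y + 2 * min (bdist G x) (bdist G y))"

definition p_fun :: "complex set \<Rightarrow> complex \<Rightarrow> complex \<Rightarrow> real" where
  "p_fun G x y = dist x y / sqrt ((dist x y)\<^sup>2 + 4 * bdist G x * bdist G y)"

definition sharp_upper :: "complex set \<Rightarrow> (complex \<Rightarrow> complex \<Rightarrow> real) \<Rightarrow> real
    \<Rightarrow> (complex \<Rightarrow> complex \<Rightarrow> real) \<Rightarrow> bool" where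
  "sharp_upper G f c g \<longleftrightarrow> (\<forall>c' < c. \<exists>x\<in>G. \<exists>y\<in>G. x \<noteq> y \<and> f x y > c' * g x y)"

definition sharp_lower :: "complex set \<Rightarrow> real \<Rightarrow> (complex \<Rightarrow> complex \<Rightarrow> real)
    \<Rightarrow> (complex \<Rightarrow> complex \<Rightarrow> real) \<Rightarrow> bool" where
  "sharp_lower G c g f \<longleftrightarrow> (\<forall>c' > c. \<exists>x\<in>G. \<exists>y\<in>G. x \<noteq> y \<and> f x y < c' * g x y)"

end

theory Submission
  imports Defs
begin

text \<open>Write x = a e^{i\<alpha>} and y = b e^{i\<beta>}. All three quantities are |x - y| divided by a
  denominator: for s it is the length L of the shortest detour from x to y via the boundary, for p it
  is the square root of T = |x - y|^2 + 4 d(x) d(y), and for j* it is |x - y| + 2 min(d(x), d(y)).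
  The comparison of p with j* and the bound j* \<le> s hold in every domain. Part (3) follows from (5) and
  (1), and the upper bound of (2) from (4) and (1), so the core is to compare L^2 with T.

  By symmetry in x, y and reflection in the bisector, assume \<alpha> \<le> \<beta> and \<alpha> + \<beta> \<le> \<theta>. The shortest
  detour then uses the ray of argument 0: it is the reflected distance if \<alpha> + \<beta> \<le> \<pi>, passes through
  the origin if \<alpha> + \<beta> \<ge> \<pi> \<ge> \<beta> - \<alpha>, and is the segment [x, y] itself if \<beta> - \<alpha> \<ge> \<pi>. All
  competitors have the form (a - b)^2 + 4ab K with K depending only on the angles, e.g.
  K = sin^2((\<beta> - \<alpha>)/2) for |x - y|^2, K = sin^2((\<alpha> + \<beta>)/2) for the reflected distance and K = 1 for
  the origin. Hence each bound reduces to an inequality between the values of K.\<close>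

section \<open>Polar coordinates and the boundary of a sector\<close>

lemma dist_rcis_squared:
  "(dist (rcis a \<alpha>) (rcis b \<beta>))\<^sup>2 = a\<^sup>2 + b\<^sup>2 - 2 * a * b * cos (\<alpha> - \<beta>)"
proof -
  have "(dist (rcis a \<alpha>) (rcis b \<beta>))\<^sup>2
      = (a * cos \<alpha> - b * cos \<beta>)\<^sup>2 + (a * sin \<alpha> - b * sin \<beta>)\<^sup>2"
    unfolding dist_norm cmod_power2 by simp
  also have "\<dots> = a\<^sup>2 * ((sin \<alpha>)\<^sup>2 + (cos \<alpha>)\<^sup>2) + b\<^sup>2 * ((sin \<beta>)\<^sup>2 + (cos \<beta>)\<^sup>2)
        - 2 * a * b * (cos \<alpha> * cos \<beta> + sin \<alpha> * sin \<beta>)"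
    by algebra
  finally show ?thesis by (simp only: cos_diff sin_cos_squared_add mult_1_right)
qed

lemma dist_rcis_cong:
  assumes "cos (\<alpha> - \<beta>) = cos (\<alpha>' - \<beta>')"
  shows "dist (rcis a \<alpha>) (rcis b \<beta>) = dist (rcis a \<alpha>') (rcis b \<beta>')"
  using assms by (simp add: power2_eq_iff_nonneg[symmetric] dist_rcis_squared del: power2_eq_iff_nonneg)

lemma rcis_minus_2pi: "rcis r (\<phi> - 2 * pi) = rcis r \<phi>"
  by (simp add: rcis_def cis_divide[symmetric])

lemma sin_squared_minus: "(sin x)\<^sup>2 - (sin y)\<^sup>2 = sin (x + y) * sin (x - y)" for x y :: real
proof -
  have "(cos x)\<^sup>2 = 1 - (sin x)\<^sup>2" "(cos y)\<^sup>2 = 1 - (sin y)\<^sup>2"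
    by (simp_all add: cos_squared_eq)
  moreover have "sin (x + y) * sin (x - y) = (sin x)\<^sup>2 * (cos y)\<^sup>2 - (cos x)\<^sup>2 * (sin y)\<^sup>2"
    by (simp add: sin_add sin_diff power2_eq_square algebra_simps)
  ultimately show ?thesis by algebra
qed

text \<open>The law of cosines with the cosine replaced by a half-angle sine. In this form all
  lengths to be compared share the term (a - b)^2 and differ only in the coefficient of 4ab.\<close>

lemma dist_rcis_half_angle:
  "(dist (rcis a \<alpha>) (rcis b \<beta>))\<^sup>2 = (a - b)\<^sup>2 + 4 * a * b * (sin ((\<beta> - \<alpha>) / 2))\<^sup>2"
proof -
  have "2 * ((\<beta> - \<alpha>) / 2) = \<beta> - \<alpha>"
    by (simp only: times_divide_eq_right) simp
  then have "cos (\<alpha> - \<beta>) = cos (2 * ((\<beta> - \<alpha>) / 2))"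
    using cos_minus[of "\<beta> - \<alpha>"] by (simp only: minus_diff_eq)
  then have "cos (\<alpha> - \<beta>) = 1 - 2 * (sin ((\<beta> - \<alpha>) / 2))\<^sup>2"
    unfolding cos_double_sin .
  then show ?thesis
    unfolding dist_rcis_squared by algebra
qed

text \<open>The left side is the component of the difference vector in the direction \<alpha>.
  Adding two such bounds shows when a path over a boundary ray is no shorter than the path through
  the vertex.\<close>

lemma dist_rcis_ge_projection:
  "a - r * cos (\<gamma> - \<alpha>) \<le> dist (rcis a \<alpha>) (rcis r \<gamma>)"
proof (rule power2_le_imp_le)
  have "(cos (\<gamma> - \<alpha>))\<^sup>2 \<le> 1"
    by (simp add: abs_square_le_1)
  then have "0 \<le> r\<^sup>2 * (1 - (cos (\<gamma> - \<alpha>))\<^sup>2)"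
    by simp
  also have "\<dots> = (dist (rcis a \<alpha>) (rcis r \<gamma>))\<^sup>2 - (a - r * cos (\<gamma> - \<alpha>))\<^sup>2"
    unfolding dist_rcis_squared cos_minus[of "\<gamma> - \<alpha>", simplified] by algebra
  finally show "(a - r * cos (\<gamma> - \<alpha>))\<^sup>2 \<le> (dist (rcis a \<alpha>) (rcis r \<gamma>))\<^sup>2"
    by simp
qed simp

text \<open>With an opening of at most pi the segment cannot pass behind the vertex, so it meets
  every ray between its endpoints; for opening pi it does so in the vertex.\<close>

lemma ray_crosses_segment:
  assumes "0 < a" "0 < b" "\<alpha> < \<gamma>" "\<gamma> < \<beta>" "\<beta> - \<alpha> \<le> pi"
  obtains r where "0 \<le> r" "dist (rcis a \<alpha>) (rcis r \<gamma>) + dist (rcis r \<gamma>) (rcis b \<beta>)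
    = dist (rcis a \<alpha>) (rcis b \<beta>)"
proof -
  \<comment> \<open>\<open>A\<close> and \<open>B\<close> are the distances of the endpoints from
    the line of argument \<gamma>, so the crossing point divides the segment in the ratio
    \<open>A : B\<close>.\<close>
  define A B where "A = a * sin (\<gamma> - \<alpha>)" and "B = b * sin (\<beta> - \<gamma>)"
  have pos: "0 < A" "0 < B"
    unfolding A_def B_def using assms by (auto intro!: mult_pos_pos sin_gt_zero)
  \<comment> \<open>Found by cutting the triangle spanned by 0 and the two points along the ray and
    equating areas.\<close>
  define r where "r = a * b * sin (\<beta> - \<alpha>) / (A + B)"
  have "0 \<le> r"
    unfolding r_def using assms pos by (auto intro!: divide_nonneg_pos mult_nonneg_nonneg sin_ge_zero)
  have sc: "sin (\<beta> - \<gamma>) * cos \<alpha> + sin (\<gamma> - \<alpha>) * cos \<beta> = sin (\<beta> - \<alpha>) * cos \<gamma>"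
           "sin (\<beta> - \<gamma>) * sin \<alpha> + sin (\<gamma> - \<alpha>) * sin \<beta> = sin (\<beta> - \<alpha>) * sin \<gamma>"
    by (simp_all add: sin_diff algebra_simps)
  have "B * (a * cos \<alpha>) + A * (b * cos \<beta>) = a * b * (sin (\<beta> - \<alpha>) * cos \<gamma>)"
       "B * (a * sin \<alpha>) + A * (b * sin \<beta>) = a * b * (sin (\<beta> - \<alpha>) * sin \<gamma>)"
    unfolding sc[symmetric] A_def B_def by (simp_all add: algebra_simps)
  then have "r * cos \<gamma> = B / (A + B) * (a * cos \<alpha>) + A / (A + B) * (b * cos \<beta>)"
            "r * sin \<gamma> = B / (A + B) * (a * sin \<alpha>) + A / (A + B) * (b * sin \<beta>)"
    unfolding r_def by (simp_all add: add_divide_distrib[symmetric])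
  moreover have "1 - A / (A + B) = B / (A + B)"
    using pos by (simp add: field_simps)
  ultimately have "rcis r \<gamma> = (1 - A / (A + B)) *\<^sub>R rcis a \<alpha> + (A / (A + B)) *\<^sub>R rcis b \<beta>"
    by (simp add: complex_eq_iff)
  then have "rcis r \<gamma> \<in> closed_segment (rcis a \<alpha>) (rcis b \<beta>)"
    unfolding in_segment using pos by (intro exI[of _ "A / (A + B)"]) auto
  then have "dist (rcis a \<alpha>) (rcis r \<gamma>) + dist (rcis r \<gamma>) (rcis b \<beta>) = dist (rcis a \<alpha>) (rcis b \<beta>)"
    unfolding between_mem_segment[symmetric] between by simp
  with \<open>0 \<le> r\<close> show thesis using that by blast
qed

text \<open>Reflection in the line of argument \<gamma> through 0 sends argument \<alpha> to
  \<open>2 * \<gamma> - \<alpha>\<close> and fixes the points of that line.\<close>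

lemma dist_rcis_reflection:
  "dist (rcis a \<alpha>) (rcis r \<gamma>) = dist (rcis a (2 * \<gamma> - \<alpha>)) (rcis r \<gamma>)"
  using cos_minus[of "\<gamma> - \<alpha>"] by (intro dist_rcis_cong) (simp add: algebra_simps)

text \<open>Heron's reflection trick: unfolding the path at its point on the line reduces the bound
  to the triangle inequality.\<close>

lemma reflected_dist_le:
  "dist (rcis a (2 * \<gamma> - \<alpha>)) (rcis b \<beta>)
    \<le> dist (rcis a \<alpha>) (rcis r \<gamma>) + dist (rcis r \<gamma>) (rcis b \<beta>)"
  unfolding dist_rcis_reflection[of a \<alpha>] by (rule dist_triangle)

text \<open>The sines give the signed distances of the points from the reflecting line, so the
  squared reflected distance has the shape of the point pair denominator.\<close>

lemma reflected_dist_squared: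
  "(dist (rcis a (2 * \<gamma> - \<alpha>)) (rcis b \<beta>))\<^sup>2
    = (dist (rcis a \<alpha>) (rcis b \<beta>))\<^sup>2 + 4 * (a * sin (\<gamma> - \<alpha>)) * (b * sin (\<gamma> - \<beta>))"
proof -
  have "cos (\<alpha> - \<beta>) = cos ((\<gamma> - \<alpha>) - (\<gamma> - \<beta>))"
    using cos_minus[of "\<beta> - \<alpha>"] by simp
  then have 1: "cos (\<alpha> - \<beta>) = cos (\<gamma> - \<alpha>) * cos (\<gamma> - \<beta>) + sin (\<gamma> - \<alpha>) * sin (\<gamma> - \<beta>)"
    unfolding cos_diff[of "\<gamma> - \<alpha>"] .
  have "2 * \<gamma> - \<alpha> - \<beta> = (\<gamma> - \<alpha>) + (\<gamma> - \<beta>)"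
    by simp
  then have 2: "cos (2 * \<gamma> - \<alpha> - \<beta>)
      = cos (\<gamma> - \<alpha>) * cos (\<gamma> - \<beta>) - sin (\<gamma> - \<alpha>) * sin (\<gamma> - \<beta>)"
    by (simp only: cos_add)
  show ?thesis
    unfolding dist_rcis_squared 1 2 by algebra
qed

section \<open>The boundary rays of a sector\<close>

definition rays :: "real \<Rightarrow> complex set" where
  "rays \<theta> = {rcis r \<gamma> |r \<gamma>. 0 \<le> r \<and> (\<gamma> = 0 \<or> \<gamma> = \<theta>)}"

lemma Arg2pi_rcis: "\<lbrakk>0 < r; 0 \<le> \<phi>; \<phi> < 2 * pi\<rbrakk> \<Longrightarrow> Arg2pi (rcis r \<phi>) = \<phi>"
  by (rule Arg2pi_unique[of r]) (simp_all add: rcis_def cis_conv_exp)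

lemma rcis_Arg2pi: "rcis (cmod z) (Arg2pi z) = z"
  using Arg2pi_eq[of z] by (simp add: rcis_def cis_conv_exp)

lemma nonneg_Reals_iff_Arg2pi: "z \<in> \<real>\<^sub>\<ge>\<^sub>0 \<longleftrightarrow> Arg2pi z = 0"
  using Arg2pi_eq_0[of z] by (auto simp: complex_nonneg_Reals_iff complex_is_Real_iff)

text \<open>\<open>Arg2pi\<close> is continuous off the nonnegative real axis, which is exactly the
  set where it vanishes. This covers both the sector and the complement of its closure.\<close>

lemma open_Arg2pi_preimage:
  assumes "open T"
  shows "open {z. Arg2pi z \<noteq> 0 \<and> Arg2pi z \<in> T}"
proof -
  have "open (Arg2pi -` T \<inter> (- \<real>\<^sub>\<ge>\<^sub>0))"
    using assms by (intro continuous_on_open_vimage[THEN iffD1, rule_format])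
      (auto intro!: continuous_at_imp_continuous_on continuous_at_Arg2pi open_Compl)
  moreover have "Arg2pi -` T \<inter> (- \<real>\<^sub>\<ge>\<^sub>0) = {z. Arg2pi z \<noteq> 0 \<and> Arg2pi z \<in> T}"
    by (auto simp: nonneg_Reals_iff_Arg2pi)
  ultimately show ?thesis by simp
qed

lemma sector_eq: "sector \<theta> = {z. Arg2pi z \<noteq> 0 \<and> Arg2pi z \<in> {..<\<theta>}}"
  by (auto simp: sector_def less_le Arg2pi_ge_0)

lemma rcis_in_sector:
  assumes "0 < r" "0 < \<phi>" "\<phi> < \<theta>" "\<theta> < 2 * pi"
  shows "rcis r \<phi> \<in> sector \<theta>"
  using assms by (auto simp: sector_def Arg2pi_rcis)

lemma sectorE:
  assumes "z \<in> sector \<theta>"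
  obtains r \<phi> where "z = rcis r \<phi>" "0 < r" "0 < \<phi>" "\<phi> < \<theta>"
proof (rule that)
  show "z = rcis (cmod z) (Arg2pi z)"
    by (simp add: rcis_Arg2pi)
qed (use assms in \<open>auto simp: sector_def\<close>)

lemma rays_iff:
  assumes "0 < \<theta>" "\<theta> < 2 * pi"
  shows "z \<in> rays \<theta> \<longleftrightarrow> Arg2pi z = 0 \<or> Arg2pi z = \<theta>"
proof
  assume "z \<in> rays \<theta>"
  then obtain r \<gamma> where "z = rcis r \<gamma>" "0 \<le> r" "\<gamma> = 0 \<or> \<gamma> = \<theta>"
    by (auto simp: rays_def)
  then show "Arg2pi z = 0 \<or> Arg2pi z = \<theta>"
    \<comment> \<open>The vertex is covered through the convention
      \<open>Arg2pi 0 = 0\<close>.\<close>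
    using assms Arg2pi_rcis[of r \<gamma>] by (cases "r = 0") auto
next
  assume "Arg2pi z = 0 \<or> Arg2pi z = \<theta>"
  moreover have "z = rcis (cmod z) (Arg2pi z)"
    by (simp add: rcis_Arg2pi)
  ultimately show "z \<in> rays \<theta>"
    unfolding rays_def mem_Collect_eq by (metis norm_ge_zero)
qed

text \<open>The sector is open and becomes closed when the rays are added; what remains is to
  approach every point of the rays from inside.\<close>

lemma frontier_sector:
  assumes "0 < \<theta>" "\<theta> < 2 * pi"
  shows "frontier (sector \<theta>) = rays \<theta>"
proof -
  have op: "open (sector \<theta>)"
    unfolding sector_eq by (intro open_Arg2pi_preimage) simp
  have "- (sector \<theta> \<union> rays \<theta>) = {z. Arg2pi z \<noteq> 0 \<and> Arg2pi z \<in> {\<theta><..}}"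
    using assms by (auto simp: sector_eq rays_iff)
  then have cl: "closed (sector \<theta> \<union> rays \<theta>)"
    unfolding closed_def by (simp only: open_Arg2pi_preimage[OF open_greaterThan])
  have "rays \<theta> \<subseteq> closure (sector \<theta>)"
  proof
    fix z assume "z \<in> rays \<theta>"
    then obtain r \<gamma> where z: "z = rcis r \<gamma>" "0 \<le> r" "\<gamma> = 0 \<or> \<gamma> = \<theta>"
      by (auto simp: rays_def)
    \<comment> \<open>Turning into the sector means increasing the argument 0 and decreasing the
      argument \<theta>; the modulus \<open>r + t\<close> below keeps points approaching the vertex
      nonzero.\<close>
    define k :: real where "k = (if \<gamma> = 0 then 1 else -1)"
    have "((\<lambda>t. rcis (r + t) (\<gamma> + k * t)) \<longlongrightarrow> rcis (r + 0) (\<gamma> + k * 0)) (at_right 0)"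
      unfolding rcis_def cis.code by (intro tendsto_intros tendsto_Complex)
    moreover have "\<forall>\<^sub>F t in at_right 0. rcis (r + t) (\<gamma> + k * t) \<in> closure (sector \<theta>)"
      using eventually_at_right_less eventually_at_right_real[OF assms(1)]
    proof eventually_elim
      case (elim t)
      then have "rcis (r + t) (\<gamma> + k * t) \<in> sector \<theta>"
        using z assms by (intro rcis_in_sector) (auto simp: k_def)
      then show ?case using closure_subset by blast
    qed
    ultimately have "rcis (r + 0) (\<gamma> + k * 0) \<in> closure (sector \<theta>)"
      by (intro Lim_in_closed_set[OF closed_closure]) simp_all
    then show "z \<in> closure (sector \<theta>)"
      using z(1) by simp
  qed
  moreover have "closure (sector \<theta>) \<subseteq> sector \<theta> \<union> rays \<theta>"
    by (intro closure_minimal cl) simp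
  moreover have "sector \<theta> \<inter> rays \<theta> = {}"
    using assms by (auto simp: sector_eq rays_iff)
  ultimately show ?thesis
    unfolding frontier_def using op closure_subset[of "sector \<theta>"] by (auto simp: interior_open)
qed

section \<open>Boundary distance and detours\<close>

lemma cos_le_cos_between:
  assumes "0 \<le> \<mu>" "\<mu> \<le> \<delta>" "\<delta> \<le> 2 * pi - \<mu>"
  shows "cos \<delta> \<le> cos \<mu>"
proof (cases "\<delta> \<le> pi")
  case True
  then show ?thesis using assms by (intro cos_monotone_0_pi_le) auto
next
  case False
  then have "cos (2 * pi - \<delta>) \<le> cos \<mu>"
    using assms by (intro cos_monotone_0_pi_le) auto
  then show ?thesis by (simp add: cos_diff)
qed

lemma sin_le_sin_between:
  assumes "0 \<le> \<mu>" "\<mu> \<le> \<delta>" "\<delta> \<le> pi - \<mu>"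
  shows "sin \<mu> \<le> sin \<delta>"
proof -
  have "\<bar>\<delta> - pi / 2\<bar> \<le> pi / 2 - \<mu>" using assms by auto
  then have "cos (pi / 2 - \<mu>) \<le> cos \<bar>\<delta> - pi / 2\<bar>"
    using assms by (intro cos_monotone_0_pi_le) auto
  then show ?thesis by (simp add: cos_diff)
qed

lemma cos_nonpos: "pi / 2 \<le> x \<Longrightarrow> x \<le> 3 * pi / 2 \<Longrightarrow> cos x \<le> 0"
  using cos_le_cos_between[of "pi / 2" x] by simp

lemma zero_in_rays: "0 \<in> rays \<theta>"
  unfolding rays_def mem_Collect_eq by (intro exI[of _ 0] exI[of _ "0::real"]) simp

lemma rcis_in_rays: "0 \<le> r \<Longrightarrow> rcis r 0 \<in> rays \<theta>" "0 \<le> r \<Longrightarrow> rcis r \<theta> \<in> rays \<theta>"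
  unfolding rays_def by blast+

text \<open>The boundary distance at modulus 1. For an angle of at most pi/2 to the nearer ray it is
  the sine of that angle; beyond, the vertex is the nearest boundary point and the cap gives the
  value 1.\<close>

definition sector_depth :: "real \<Rightarrow> real \<Rightarrow> real" where
  "sector_depth \<theta> \<alpha> = sin (min (min \<alpha> (\<theta> - \<alpha>)) (pi / 2))"

lemma sector_depth_reflect: "sector_depth \<theta> (\<theta> - \<alpha>) = sector_depth \<theta> \<alpha>"
  by (simp add: sector_depth_def min.commute)

lemma sector_depth_pos: "\<lbrakk>0 < \<alpha>; \<alpha> < \<theta>\<rbrakk> \<Longrightarrow> 0 < sector_depth \<theta> \<alpha>"
  unfolding sector_depth_def by (intro sin_gt_zero) (auto simp: min_def)

lemma bdist_sector:
  assumes "0 < a" "0 < \<alpha>" "\<alpha> < \<theta>" "\<theta> < 2 * pi"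
  shows "bdist (sector \<theta>) (rcis a \<alpha>) = a * sector_depth \<theta> \<alpha>"
proof -
  define \<mu> where "\<mu> = min (min \<alpha> (\<theta> - \<alpha>)) (pi / 2)"
  have \<mu>: "0 < \<mu>" "\<mu> \<le> \<alpha>" "\<mu> \<le> \<theta> - \<alpha>" "\<mu> \<le> pi / 2"
    using assms by (auto simp: \<mu>_def min_def)
  have "0 \<le> cos \<mu>" "0 \<le> sin \<mu>"
    using \<mu> by (auto intro!: cos_ge_zero sin_ge_zero)
  \<comment> \<open>Splits the squared distance to a point at angle \<mu> and radius
    \<open>r\<close> into the height and the offset from the foot of the perpendicular, which has
    radius \<open>a * cos \<mu>\<close>.\<close>
  have foot: "(a * sin \<mu>)\<^sup>2 + (r - a * cos \<mu>)\<^sup>2 = a\<^sup>2 + r\<^sup>2 - 2 * a * r * cos \<mu>" for r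
    using sin_cos_squared_add[of \<mu>] by algebra
  have "a * sin \<mu> \<le> infdist (rcis a \<alpha>) (rays \<theta>)"
  proof -
    have "a * sin \<mu> \<le> dist (rcis a \<alpha>) z" if z: "z \<in> rays \<theta>" for z
    proof -
      from z obtain r \<gamma> where r: "z = rcis r \<gamma>" "0 \<le> r" "\<gamma> = 0 \<or> \<gamma> = \<theta>"
        by (auto simp: rays_def)
      have "cos (\<alpha> - \<gamma>) \<le> cos \<mu>"
        using r(3)
      proof
        assume "\<gamma> = \<theta>"
        then show ?thesis
          using cos_le_cos_between[of \<mu> "\<theta> - \<alpha>"] cos_minus[of "\<theta> - \<alpha>"] \<mu> assms by simp
      qed (use cos_le_cos_between[of \<mu> \<alpha>] \<mu> assms in simp)
      then have "2 * a * r * cos (\<alpha> - \<gamma>) \<le> 2 * a * r * cos \<mu>"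
        using r(2) assms by (intro mult_left_mono) auto
      then have "(a * sin \<mu>)\<^sup>2 + (r - a * cos \<mu>)\<^sup>2 \<le> (dist (rcis a \<alpha>) z)\<^sup>2"
        unfolding foot r(1) dist_rcis_squared by simp
      then have "(a * sin \<mu>)\<^sup>2 \<le> (dist (rcis a \<alpha>) z)\<^sup>2"
        using zero_le_power2[of "r - a * cos \<mu>"] by linarith
      then show ?thesis by (rule power2_le_imp_le) simp
    qed
    then show ?thesis
      using zero_in_rays[of \<theta>] by (subst infdist_notempty) (auto intro!: cINF_greatest)
  qed
  moreover have "infdist (rcis a \<alpha>) (rays \<theta>) \<le> a * sin \<mu>"
  proof -
    \<comment> \<open>The ray on which the minimum is attained. If \<mu> = pi/2 either ray serves,
      the foot then being the vertex.\<close>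
    obtain \<gamma> where \<gamma>: "\<gamma> = 0 \<or> \<gamma> = \<theta>" "cos (\<alpha> - \<gamma>) = cos \<mu> \<or> \<mu> = pi / 2"
    proof -
      consider "\<mu> = \<alpha>" | "\<mu> = \<theta> - \<alpha>" | "\<mu> = pi / 2"
        unfolding \<mu>_def by linarith
      then show thesis
        using that[of 0] that[of \<theta>] cos_minus[of "\<theta> - \<alpha>"] by cases simp_all
    qed
    have "rcis (a * cos \<mu>) \<gamma> \<in> rays \<theta>"
      using \<gamma>(1) \<open>0 \<le> cos \<mu>\<close> assms rcis_in_rays[of "a * cos \<mu>" \<theta>] by auto
    moreover have "dist (rcis a \<alpha>) (rcis (a * cos \<mu>) \<gamma>) = a * sin \<mu>"
    proof (rule power2_eq_imp_eq)
      have "2 * a * (a * cos \<mu>) * cos (\<alpha> - \<gamma>) = 2 * a * (a * cos \<mu>) * cos \<mu>"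
        using \<gamma>(2) by (elim disjE) (simp, simp only: cos_pi_half mult_zero_left mult_zero_right)
      then show "(dist (rcis a \<alpha>) (rcis (a * cos \<mu>) \<gamma>))\<^sup>2 = (a * sin \<mu>)\<^sup>2"
        by (simp only: dist_rcis_squared foot[of "a * cos \<mu>", symmetric]) simp
    qed (use \<open>0 \<le> sin \<mu>\<close> assms in auto)
    ultimately show ?thesis
      using infdist_le by metis
  qed
  ultimately show ?thesis
    using assms by (simp add: bdist_def frontier_sector sector_depth_def \<mu>_def)
qed

section \<open>Shortest detours via the boundary of an arbitrary set\<close>

definition detour :: "complex set \<Rightarrow> complex \<Rightarrow> complex \<Rightarrow> real" where
  "detour G x y = (INF z\<in>frontier G. dist x z + dist z y)"

lemma detour_le:
  assumes "z \<in> frontier G"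
  shows "detour G x y \<le> dist x z + dist z y"
  unfolding detour_def using assms by (intro cINF_lower bdd_belowI2[of _ 0]) auto

lemma detour_ge:
  assumes "frontier G \<noteq> {}" "\<And>z. z \<in> frontier G \<Longrightarrow> c \<le> dist x z + dist z y"
  shows "c \<le> detour G x y"
  unfolding detour_def using assms by (intro cINF_greatest) auto

lemma dist_le_detour: "frontier G \<noteq> {} \<Longrightarrow> dist x y \<le> detour G x y"
  by (intro detour_ge dist_triangle)

text \<open>Going from \<open>w\<close> to its nearest boundary point, back, and straight on to the
  other point costs at most the right side. This yields the bound of \<open>j_star\<close> by
  \<open>s_metric\<close>.\<close>

lemma detour_le_bdist:
  assumes "frontier G \<noteq> {}"
  shows "detour G x y \<le> dist x y + 2 * min (bdist G x) (bdist G y)"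
proof -
  have "detour G x y \<le> dist x y + 2 * bdist G w" if "w = x \<or> w = y" for w
  proof -
    obtain z where "z \<in> frontier G" "infdist w (frontier G) = dist w z"
      using infdist_attains_inf[OF frontier_closed assms] by blast
    then show ?thesis
      using detour_le[of z G x y] that dist_triangle[of x z y] dist_triangle[of z y x]
      by (auto simp: bdist_def dist_commute)
  qed
  from this[of x] this[of y] show ?thesis by (auto simp: min_def)
qed

lemma detour_commute: "detour G x y = detour G y x"
  by (simp add: detour_def dist_commute add.commute)

text \<open>Reflection in the bisector replaces each argument \<phi> by \<theta> - \<phi> and
  exchanges the two rays. It is an involution, so one inequality suffices.\<close>

lemma detour_sector_reflect:
  assumes "0 < \<theta>" "\<theta> < 2 * pi"
  shows "detour (sector \<theta>) (rcis a \<alpha>) (rcis b \<beta>)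
    = detour (sector \<theta>) (rcis a (\<theta> - \<alpha>)) (rcis b (\<theta> - \<beta>))"
proof -
  have le: "detour (sector \<theta>) (rcis a (\<theta> - \<alpha>)) (rcis b (\<theta> - \<beta>))
    \<le> detour (sector \<theta>) (rcis a \<alpha>) (rcis b \<beta>)" for \<alpha> \<beta>
  proof (rule detour_ge)
    fix z assume "z \<in> frontier (sector \<theta>)"
    then obtain r \<gamma> where z: "z = rcis r \<gamma>" "0 \<le> r" "\<gamma> = 0 \<or> \<gamma> = \<theta>"
      using frontier_sector[OF assms] by (auto simp: rays_def)
    have "rcis r (\<theta> - \<gamma>) \<in> frontier (sector \<theta>)"
      using z rcis_in_rays[of r \<theta>] by (auto simp: frontier_sector[OF assms])
    then have "detour (sector \<theta>) (rcis a (\<theta> - \<alpha>)) (rcis b (\<theta> - \<beta>))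
      \<le> dist (rcis a (\<theta> - \<alpha>)) (rcis r (\<theta> - \<gamma>)) + dist (rcis r (\<theta> - \<gamma>)) (rcis b (\<theta> - \<beta>))"
      by (rule detour_le)
    also have "\<dots> = dist (rcis a \<alpha>) z + dist z (rcis b \<beta>)"
      unfolding z(1) using cos_minus[of "\<alpha> - \<gamma>"] cos_minus[of "\<gamma> - \<beta>"]
      by (intro arg_cong2[of _ _ _ _ "(+)"] dist_rcis_cong) simp_all
    finally show "detour (sector \<theta>) (rcis a (\<theta> - \<alpha>)) (rcis b (\<theta> - \<beta>))
      \<le> dist (rcis a \<alpha>) z + dist z (rcis b \<beta>)" .
  qed (use zero_in_rays[of \<theta>] in \<open>auto simp: frontier_sector[OF assms]\<close>)
  from le[of \<alpha> \<beta>] le[of "\<theta> - \<alpha>" "\<theta> - \<beta>"] show ?thesis by simp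
qed

text \<open>The segment from the mirror image at argument -\<alpha> to the second point opens an
  angle \<alpha> + \<beta> \<le> pi and so meets the ray of argument 0; folded back, it is an
  admissible detour.\<close>

lemma detour_le_crossing:
  assumes "0 < \<theta>" "\<theta> < 2 * pi" "0 < a" "0 < b" "0 < \<alpha>" "0 < \<beta>" "\<alpha> + \<beta> \<le> pi"
  shows "(detour (sector \<theta>) (rcis a \<alpha>) (rcis b \<beta>))\<^sup>2
    \<le> (dist (rcis a \<alpha>) (rcis b \<beta>))\<^sup>2 + 4 * (a * sin \<alpha>) * (b * sin \<beta>)"
proof -
  obtain r where r: "0 \<le> r" "dist (rcis a (- \<alpha>)) (rcis r 0) + dist (rcis r 0) (rcis b \<beta>)
      = dist (rcis a (- \<alpha>)) (rcis b \<beta>)"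
    using ray_crosses_segment[of a b "- \<alpha>" 0 \<beta>] assms by auto
  have "detour (sector \<theta>) (rcis a \<alpha>) (rcis b \<beta>)
      \<le> dist (rcis a \<alpha>) (rcis r 0) + dist (rcis r 0) (rcis b \<beta>)"
    using r(1) assms by (intro detour_le) (simp only: frontier_sector rcis_in_rays)
  \<comment> \<open>The form \<open>2 * 0 - \<alpha>\<close> is kept so that
    \<open>reflected_dist_squared\<close> applies with \<gamma> = 0.\<close>
  also have "\<dots> = dist (rcis a (2 * 0 - \<alpha>)) (rcis b \<beta>)"
    using r(2) dist_rcis_reflection[of a \<alpha> r 0] by simp
  finally have "(detour (sector \<theta>) (rcis a \<alpha>) (rcis b \<beta>))\<^sup>2
      \<le> (dist (rcis a (2 * 0 - \<alpha>)) (rcis b \<beta>))\<^sup>2"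
    by (rule power_mono) (use zero_in_rays[of \<theta>] assms
      in \<open>auto intro!: detour_ge simp: frontier_sector\<close>)
  then show ?thesis
    unfolding reflected_dist_squared by simp
qed

lemma detour_le_add:
  assumes "0 < \<theta>" "\<theta> < 2 * pi" "0 \<le> a" "0 \<le> b"
  shows "detour (sector \<theta>) (rcis a \<alpha>) (rcis b \<beta>) \<le> a + b"
  using detour_le[of 0 "sector \<theta>" "rcis a \<alpha>" "rcis b \<beta>"] zero_in_rays[of \<theta>] assms
  by (simp add: frontier_sector)

text \<open>Measured through argument 0, the points open an angle 2 pi - (\<beta> - \<alpha>) \<le>
  pi, so the segment between them itself meets the boundary.\<close>

lemma detour_le_dist:
  assumes "0 < \<theta>" "\<theta> < 2 * pi" "0 < a" "0 < b" "0 < \<alpha>" "\<beta> < 2 * pi" "pi \<le> \<beta> - \<alpha>"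
  shows "detour (sector \<theta>) (rcis a \<alpha>) (rcis b \<beta>) \<le> dist (rcis a \<alpha>) (rcis b \<beta>)"
proof -
  obtain r where r: "0 \<le> r" "dist (rcis b (\<beta> - 2 * pi)) (rcis r 0) + dist (rcis r 0) (rcis a \<alpha>)
      = dist (rcis b (\<beta> - 2 * pi)) (rcis a \<alpha>)"
    using ray_crosses_segment[of b a "\<beta> - 2 * pi" 0 \<alpha>] assms by auto
  have "rcis r 0 \<in> frontier (sector \<theta>)"
    using r(1) assms by (simp only: frontier_sector rcis_in_rays)
  from detour_le[OF this, of "rcis a \<alpha>" "rcis b \<beta>"] r(2) show ?thesis
    unfolding rcis_minus_2pi by (simp add: dist_commute)
qed

text \<open>In a half-plane the shortest detour is found by reflecting one point in the boundary line.
  A convex sector lies in the half-planes bounded by the lines through its two rays.\<close>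

lemma convex_detour_ge:
  assumes "0 < \<theta>" "\<theta> \<le> pi" "0 < a" "0 < b" "0 < \<alpha>" "\<alpha> < \<theta>" "0 < \<beta>" "\<beta> < \<theta>"
  shows "(dist (rcis a \<alpha>) (rcis b \<beta>))\<^sup>2 + 4 * (a * sector_depth \<theta> \<alpha>) * (b * sector_depth \<theta> \<beta>)
    \<le> (detour (sector \<theta>) (rcis a \<alpha>) (rcis b \<beta>))\<^sup>2" (is "?A \<le> ?L\<^sup>2")
proof -
  have \<theta>: "\<theta> < 2 * pi" using assms by linarith
  \<comment> \<open>At modulus 1 the two sines are the distances to the lines through the rays. When
    \<phi> is obtuse, \<theta> \<le> pi makes the other ray at least as near as the line.\<close>
  have depth: "sector_depth \<theta> \<phi> \<le> sin \<phi> \<and> sector_depth \<theta> \<phi> \<le> sin (\<theta> - \<phi>)"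
    if \<phi>: "0 < \<phi>" "\<phi> < \<theta>" for \<phi>
  proof -
    show ?thesis
      unfolding sector_depth_def using \<phi> assms
      by (auto simp: min_def intro!: sin_le_sin_between)
  qed
  have "sqrt ?A \<le> ?L"
  proof (rule detour_ge)
    fix z assume "z \<in> frontier (sector \<theta>)"
    then obtain r \<gamma> where z: "z = rcis r \<gamma>" "0 \<le> r" "\<gamma> = 0 \<or> \<gamma> = \<theta>"
      using assms \<theta> by (auto simp: frontier_sector rays_def)
    \<comment> \<open>For \<gamma> = 0 both sines on the right are negative and the signs
      cancel.\<close>
    have prod: "sector_depth \<theta> \<alpha> * sector_depth \<theta> \<beta> \<le> sin (\<gamma> - \<alpha>) * sin (\<gamma> - \<beta>)"
    proof -
      have "sector_depth \<theta> \<alpha> * sector_depth \<theta> \<beta> \<le> sin \<alpha> * sin \<beta>"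
           "sector_depth \<theta> \<alpha> * sector_depth \<theta> \<beta> \<le> sin (\<theta> - \<alpha>) * sin (\<theta> - \<beta>)"
        using depth[of \<alpha>] depth[of \<beta>] sector_depth_pos[of \<alpha> \<theta>] sector_depth_pos[of \<beta> \<theta>] assms
        by (auto intro!: mult_mono)
      then show ?thesis using z(3) by auto
    qed
    have "?A \<le> (dist (rcis a (2 * \<gamma> - \<alpha>)) (rcis b \<beta>))\<^sup>2"
      unfolding reflected_dist_squared using mult_left_mono[OF prod, of "4 * a * b"] assms
      by (simp add: algebra_simps)
    then have "sqrt ?A \<le> dist (rcis a (2 * \<gamma> - \<alpha>)) (rcis b \<beta>)"
      by (rule real_le_lsqrt[rotated]) simp
    also have "\<dots> \<le> dist (rcis a \<alpha>) z + dist z (rcis b \<beta>)"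
      unfolding z(1) by (rule reflected_dist_le)
    finally show "sqrt ?A \<le> dist (rcis a \<alpha>) z + dist z (rcis b \<beta>)" .
  qed (use zero_in_rays[of \<theta>] assms \<theta> in \<open>auto simp: frontier_sector\<close>)
  then show ?thesis by (rule sqrt_le_D)
qed

text \<open>A detour over the far ray can be traded for one over the ray of argument 0. Either the
  far point is at an angle of at least pi from one of the two points, and the segment joining them
  crosses the ray of argument 0, or the path through the vertex is no longer.\<close>

lemma nonconvex_detour_first_ray:
  assumes "pi \<le> \<theta>" "\<theta> < 2 * pi" "0 < a" "0 < b" "0 < \<alpha>" "\<alpha> < \<theta>" "0 < \<beta>" "\<beta> < \<theta>"
    "\<alpha> + \<beta> \<le> \<theta>" "z \<in> rays \<theta>"
  obtains r where "0 \<le> r"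
    "dist (rcis a \<alpha>) (rcis r 0) + dist (rcis r 0) (rcis b \<beta>) \<le> dist (rcis a \<alpha>) z + dist z (rcis b \<beta>)"
proof -
  \<comment> \<open>Through the complement of the sector the angle from the far ray to \<phi> is 2
    pi - (\<theta> - \<phi>) \<le> pi, so \<open>ray_crosses_segment\<close> applies with the far
    ray at argument \<open>\<theta> - 2 * pi\<close>.\<close>
  have crossing: "\<exists>r\<ge>0. dist (rcis c \<phi>) (rcis r 0) + dist (rcis r 0) (rcis s \<theta>) = dist (rcis c \<phi>) (rcis s \<theta>)"
    if "0 < c" "0 < s" "0 < \<phi>" "pi \<le> \<theta> - \<phi>" for c s \<phi>
    using ray_crosses_segment[of s c "\<theta> - 2 * pi" 0 \<phi>] that assms(1,2)
    unfolding rcis_minus_2pi by (auto simp: dist_commute add.commute)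
  from assms(10) obtain s \<gamma> where z: "z = rcis s \<gamma>" "0 \<le> s" "\<gamma> = 0 \<or> \<gamma> = \<theta>"
    by (auto simp: rays_def)
  consider "\<gamma> = 0" | "s = 0" | "\<gamma> = \<theta>" "0 < s" "pi \<le> \<theta> - \<alpha>" | "\<gamma> = \<theta>" "0 < s" "pi \<le> \<theta> - \<beta>"
    | "\<gamma> = \<theta>" "\<theta> - \<alpha> < pi" "\<theta> - \<beta> < pi"
    using z by linarith
  then show thesis
  proof cases
    case 1
    then show thesis using z by (intro that[of s]) auto
  next
    case 2
    then show thesis using z by (intro that[of 0]) auto
  next
    case 3
    then obtain r where "0 \<le> r"
      "dist (rcis a \<alpha>) (rcis r 0) + dist (rcis r 0) (rcis s \<theta>) = dist (rcis a \<alpha>) (rcis s \<theta>)"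
      using crossing[of a s \<alpha>] assms by auto
    then show thesis
      using z(1) 3 dist_triangle[of "rcis r 0" "rcis b \<beta>" "rcis s \<theta>"] by (intro that[of r]) auto
  next
    case 4
    then obtain r where "0 \<le> r"
      "dist (rcis b \<beta>) (rcis r 0) + dist (rcis r 0) (rcis s \<theta>) = dist (rcis b \<beta>) (rcis s \<theta>)"
      using crossing[of b s \<beta>] assms by auto
    then show thesis
      using z(1) 4 dist_triangle[of "rcis a \<alpha>" "rcis r 0" "rcis s \<theta>"]
      by (intro that[of r]) (auto simp: dist_commute)
  next
    case 5
    \<comment> \<open>The mean angle to the far ray lies between \<theta>/2 \<ge> pi/2 and pi, so
      the two projections of the far point have a nonpositive sum.\<close>
    have "cos ((2 * \<theta> - \<alpha> - \<beta>) / 2) \<le> 0" "0 \<le> cos ((\<alpha> - \<beta>) / 2)"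
      using 5 assms by (auto intro!: cos_nonpos cos_ge_zero)
    moreover have "cos (\<theta> - \<alpha>) + cos (\<theta> - \<beta>) = 2 * cos ((2 * \<theta> - \<alpha> - \<beta>) / 2) * cos ((\<beta> - \<alpha>) / 2)"
      by (subst cos_plus_cos) (simp add: field_simps)
    moreover have "cos ((\<beta> - \<alpha>) / 2) = cos ((\<alpha> - \<beta>) / 2)"
      using cos_minus[of "(\<alpha> - \<beta>) / 2"] by (simp add: minus_divide_left)
    ultimately have "cos (\<theta> - \<alpha>) + cos (\<theta> - \<beta>) \<le> 0"
      by (simp add: mult_nonpos_nonneg)
    then have "s * (cos (\<theta> - \<alpha>) + cos (\<theta> - \<beta>)) \<le> 0"
      using z(2) by (simp add: mult_nonneg_nonpos)
    then have "a + b \<le> dist (rcis a \<alpha>) z + dist z (rcis b \<beta>)"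
      using dist_rcis_ge_projection[of a s \<theta> \<alpha>] dist_rcis_ge_projection[of b s \<theta> \<beta>] z(1) 5(1)
      by (simp add: dist_commute algebra_simps)
    then show thesis using assms by (intro that[of 0]) auto
  qed
qed

text \<open>Once the boundary point is moved to the ray of argument 0, Heron's bound
  applies.\<close>

lemma nonconvex_detour_ge_reflected:
  assumes "pi \<le> \<theta>" "\<theta> < 2 * pi" "0 < a" "0 < b" "0 < \<alpha>" "\<alpha> < \<theta>" "0 < \<beta>" "\<beta> < \<theta>" "\<alpha> + \<beta> \<le> \<theta>"
  shows "dist (rcis a (- \<alpha>)) (rcis b \<beta>) \<le> detour (sector \<theta>) (rcis a \<alpha>) (rcis b \<beta>)"
proof (rule detour_ge)
  fix z assume "z \<in> frontier (sector \<theta>)"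
  then have "z \<in> rays \<theta>" using assms frontier_sector[of \<theta>] pi_gt_zero by auto
  from nonconvex_detour_first_ray[OF assms this] obtain r where
    "dist (rcis a \<alpha>) (rcis r 0) + dist (rcis r 0) (rcis b \<beta>) \<le> dist (rcis a \<alpha>) z + dist z (rcis b \<beta>)" .
  with reflected_dist_le[of a 0 \<alpha> b \<beta> r]
  show "dist (rcis a (- \<alpha>)) (rcis b \<beta>) \<le> dist (rcis a \<alpha>) z + dist z (rcis b \<beta>)" by simp
qed (use zero_in_rays[of \<theta>] frontier_sector[of \<theta>] assms pi_gt_zero in force)

text \<open>Now the mean angle to the ray of argument 0 is at least pi/2 as well, so moving the
  boundary point from the vertex out along that ray cannot shorten the path.\<close>

lemma nonconvex_detour_ge_add:
  assumes "pi \<le> \<theta>" "\<theta> < 2 * pi" "0 < a" "0 < b" "0 < \<alpha>" "\<alpha> < \<theta>" "0 < \<beta>" "\<beta> < \<theta>" "\<alpha> + \<beta> \<le> \<theta>"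
    "pi \<le> \<alpha> + \<beta>" "\<bar>\<beta> - \<alpha>\<bar> \<le> pi"
  shows "a + b \<le> detour (sector \<theta>) (rcis a \<alpha>) (rcis b \<beta>)"
proof (rule detour_ge)
  fix z assume "z \<in> frontier (sector \<theta>)"
  then have "z \<in> rays \<theta>" using assms frontier_sector[of \<theta>] pi_gt_zero by auto
  from nonconvex_detour_first_ray[OF assms(1-9) this] obtain r where r: "0 \<le> r"
    "dist (rcis a \<alpha>) (rcis r 0) + dist (rcis r 0) (rcis b \<beta>) \<le> dist (rcis a \<alpha>) z + dist z (rcis b \<beta>)" .
  have "cos ((\<alpha> + \<beta>) / 2) \<le> 0" "0 \<le> cos ((\<alpha> - \<beta>) / 2)"
    using assms by (auto intro!: cos_nonpos cos_ge_zero)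
  then have "cos \<alpha> + cos \<beta> \<le> 0"
    unfolding cos_plus_cos by (simp add: mult_nonpos_nonneg)
  then have "r * (cos \<alpha> + cos \<beta>) \<le> 0"
    using r(1) by (simp add: mult_nonneg_nonpos)
  then show "a + b \<le> dist (rcis a \<alpha>) z + dist z (rcis b \<beta>)"
    using r(2) dist_rcis_ge_projection[of a r 0 \<alpha>] dist_rcis_ge_projection[of b r 0 \<beta>]
    by (simp add: dist_commute algebra_simps)
qed (use zero_in_rays[of \<theta>] frontier_sector[of \<theta>] assms pi_gt_zero in force)

section \<open>Comparison of the shortest detour with the point pair denominator\<close>

lemma sin_times_sin_half:
  "sin \<alpha> * sin \<beta> = (sin ((\<alpha> + \<beta>) / 2))\<^sup>2 - (sin ((\<beta> - \<alpha>) / 2))\<^sup>2" for \<alpha> \<beta> :: real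
proof -
  have "(\<alpha> + \<beta>) / 2 + (\<beta> - \<alpha>) / 2 = \<beta>" "(\<alpha> + \<beta>) / 2 - (\<beta> - \<alpha>) / 2 = \<alpha>"
    by (simp_all add: field_simps)
  then show ?thesis
    unfolding sin_squared_minus by (simp only: mult.commute)
qed

text \<open>The source of the constants: exchanging the distance to the line of one ray for that of
  the other changes the sine by a multiple of \<open>cos (\<theta> / 2)\<close>.\<close>

lemma sin_diff_half: "sin \<beta> - sin (\<theta> - \<beta>) = 2 * cos (\<theta> / 2) * sin (\<beta> - \<theta> / 2)" for \<beta> \<theta> :: real
proof -
  have "\<beta> = \<theta> / 2 + (\<beta> - \<theta> / 2)" "\<theta> - \<beta> = \<theta> / 2 - (\<beta> - \<theta> / 2)"
    by simp_all
  then have "sin \<beta> = sin (\<theta> / 2) * cos (\<beta> - \<theta> / 2) + cos (\<theta> / 2) * sin (\<beta> - \<theta> / 2)"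
    "sin (\<theta> - \<beta>) = sin (\<theta> / 2) * cos (\<beta> - \<theta> / 2) - cos (\<theta> / 2) * sin (\<beta> - \<theta> / 2)"
    by (metis sin_add, metis sin_diff)
  then show ?thesis by simp
qed

lemma minus_cos_half_eq: "- cos (\<theta> / 2) = sin (\<theta> / 2 - pi / 2)"
  by (simp add: sin_diff)

text \<open>With m the half-sum and n the half-difference, 2 sin(m - n) sin n = cos(m - 2n) - cos m
  \<le> 1 - cos m \<le> sin^2 m, the last step because 0 \<le> cos m \<le> 1.\<close>

lemma double_sin_times_sin_le:
  assumes "0 \<le> \<alpha>" "\<alpha> + \<beta> \<le> pi" "0 \<le> u" "u \<le> (\<beta> - \<alpha>) / 2"
  shows "2 * sin \<alpha> * sin u \<le> (sin ((\<alpha> + \<beta>) / 2))\<^sup>2"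
proof -
  define m n where "m = (\<alpha> + \<beta>) / 2" and "n = (\<beta> - \<alpha>) / 2"
  have mn: "\<alpha> = m - n" "0 \<le> n" "n \<le> m" "m \<le> pi / 2" "u \<le> n"
    unfolding m_def n_def using assms by (auto simp: field_simps)
  have "sin u \<le> sin n" "0 \<le> sin \<alpha>"
    using mn assms by (auto intro!: sin_monotone_2pi_le sin_ge_zero)
  then have "2 * sin \<alpha> * sin u \<le> 2 * sin (m - n) * sin n"
    using mn(1) by (simp add: mult_left_mono)
  also have "\<dots> = cos (m - n - n) - cos (m - n + n)"
    by (simp only: cos_diff[of "m - n" n] cos_add[of "m - n" n])
  also have "\<dots> \<le> 1 - cos m"
    by simp
  also have "\<dots> \<le> 1 - (cos m)\<^sup>2"
    using cos_ge_zero[of m] mn mult_left_mono[of "cos m" 1 "cos m"] by (simp add: power2_eq_square)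
  finally show ?thesis
    by (simp add: m_def sin_squared_eq)
qed

lemma cos_half_nonneg: "0 \<le> \<theta> \<Longrightarrow> \<theta> \<le> pi \<Longrightarrow> 0 \<le> cos (\<theta> / 2)"
  by (rule cos_ge_zero) auto

text \<open>Up to the bisector both depths are plain sines and the two coefficients coincide. Past
  it, the loss \<open>sin \<beta> - sin (\<theta> - \<beta>)\<close> is 2 cos(\<theta>/2) sin u, and
  the factor has to absorb it.\<close>

lemma convex_depth_bound:
  assumes "0 < \<alpha>" "\<alpha> \<le> \<beta>" "\<alpha> + \<beta> \<le> \<theta>" "\<theta> \<le> pi"
  shows "(sin ((\<alpha> + \<beta>) / 2))\<^sup>2
    \<le> (1 + cos (\<theta> / 2)) * ((sin ((\<beta> - \<alpha>) / 2))\<^sup>2 + sector_depth \<theta> \<alpha> * sector_depth \<theta> \<beta>)"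
proof -
  define c where "c = cos (\<theta> / 2)"
  define N where "N = (sin ((\<beta> - \<alpha>) / 2))\<^sup>2"
  have c: "0 \<le> c" unfolding c_def using assms by (intro cos_half_nonneg) auto
  have M: "(sin ((\<alpha> + \<beta>) / 2))\<^sup>2 = N + sin \<alpha> * sin \<beta>"
    unfolding N_def sin_times_sin_half by simp
  have \<alpha>: "sector_depth \<theta> \<alpha> = sin \<alpha>" "0 \<le> sin \<alpha>"
    using assms by (auto simp: sector_depth_def min_def intro!: arg_cong[of _ _ sin] sin_ge_zero)
  have "N + sin \<alpha> * sin \<beta> \<le> (1 + c) * (N + sin \<alpha> * sector_depth \<theta> \<beta>)"
  proof (cases "\<beta> \<le> \<theta> / 2")
    case True
    then have "sector_depth \<theta> \<beta> = sin \<beta>" "0 \<le> sin \<beta>"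
      using assms by (auto simp: sector_depth_def min_def intro!: arg_cong[of _ _ sin] sin_ge_zero)
    moreover have "0 \<le> c * (N + sin \<alpha> * sin \<beta>)"
      using c \<alpha>(2) \<open>0 \<le> sin \<beta>\<close> by (simp add: N_def)
    ultimately show ?thesis by (simp add: algebra_simps)
  next
    case False
    then have depth: "sector_depth \<theta> \<beta> = sin (\<theta> - \<beta>)"
      using assms by (auto simp: sector_depth_def min_def intro!: arg_cong[of _ _ sin])
    define u where "u = \<beta> - \<theta> / 2"
    have "(sin u)\<^sup>2 \<le> N"
      unfolding N_def u_def using False assms
      by (intro power_mono sin_monotone_2pi_le sin_ge_zero) auto
    moreover have "sin \<alpha> \<le> sin (\<theta> - \<beta>)"
      using False assms by (intro sin_monotone_2pi_le) auto
    then have "sin \<alpha> * sin \<alpha> \<le> sin \<alpha> * sin (\<theta> - \<beta>)"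
      using \<alpha>(2) by (rule mult_left_mono)
    \<comment> \<open>The arithmetic-geometric mean inequality for \<open>sin \<alpha>\<close> and
      \<open>sin u\<close>, whose squares have just been estimated.\<close>
    moreover have "0 \<le> (sin \<alpha> - sin u)\<^sup>2"
      by simp
    ultimately have "2 * sin \<alpha> * sin u \<le> N + sin \<alpha> * sin (\<theta> - \<beta>)"
      by (simp add: power2_eq_square algebra_simps)
    then have "c * (2 * sin \<alpha> * sin u) \<le> c * (N + sin \<alpha> * sin (\<theta> - \<beta>))"
      using c by (rule mult_left_mono)
    moreover have "sin \<beta> = sin (\<theta> - \<beta>) + 2 * c * sin u"
      using sin_diff_half[of \<beta> \<theta>] by (simp add: u_def c_def)
    ultimately show ?thesis
      unfolding depth by (simp add: algebra_simps)
  qed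
  then show ?thesis
    unfolding M \<alpha>(1) by (simp add: c_def N_def)
qed

text \<open>Compared with a half-plane the far ray only recedes: \<open>\<theta> - \<beta>\<close>
  is at least \<open>pi - \<beta>\<close>.\<close>

lemma nonconvex_depth_ge_sin:
  assumes "0 < \<alpha>" "\<alpha> \<le> \<beta>" "\<alpha> + \<beta> \<le> pi" "pi \<le> \<theta>"
  shows "sin \<alpha> * sin \<beta> \<le> sector_depth \<theta> \<alpha> * sector_depth \<theta> \<beta>"
proof -
  have "sin \<alpha> = sector_depth \<theta> \<alpha>"
    using assms by (auto simp: sector_depth_def min_def intro!: arg_cong[of _ _ sin])
  moreover have "sin (pi - \<beta>) \<le> sin (\<theta> - \<beta>)" if "\<theta> - \<beta> \<le> pi / 2"
    using assms that by (intro sin_monotone_2pi_le) auto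
  then have "sin \<beta> \<le> sector_depth \<theta> \<beta>"
    by (auto simp: sector_depth_def min_def)
  moreover have "0 \<le> sin \<alpha>"
    using assms by (intro sin_ge_zero) auto
  ultimately show ?thesis by (simp add: mult_left_mono)
qed

text \<open>\<alpha> is the smallest angle entering the depths, and \<alpha> + \<beta> \<ge> pi
  makes it at least pi/2 - (\<beta> - \<alpha>)/2. Hence the point pair coefficient is at least 1,
  the coefficient of the path through the vertex.\<close>

lemma nonconvex_depth_ge_cos:
  assumes "0 < \<alpha>" "\<alpha> \<le> \<beta>" "pi \<le> \<alpha> + \<beta>" "\<beta> - \<alpha> \<le> pi" "\<alpha> + \<beta> \<le> \<theta>"
  shows "(cos ((\<beta> - \<alpha>) / 2))\<^sup>2 \<le> sector_depth \<theta> \<alpha> * sector_depth \<theta> \<beta>"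
proof -
  have "cos ((\<beta> - \<alpha>) / 2) = sin (pi / 2 - (\<beta> - \<alpha>) / 2)"
    by (simp add: sin_diff)
  moreover have "sin (pi / 2 - (\<beta> - \<alpha>) / 2) \<le> sector_depth \<theta> \<phi>" if "\<phi> = \<alpha> \<or> \<phi> = \<beta>" for \<phi>
    unfolding sector_depth_def using assms that
    by (intro sin_monotone_2pi_le) (auto simp: min_def field_simps)
  moreover have "0 \<le> cos ((\<beta> - \<alpha>) / 2)"
    using assms by (intro cos_ge_zero) auto
  ultimately show ?thesis
    unfolding power2_eq_square by (intro mult_mono) (auto intro: order_trans)
qed

text \<open>The reflected coefficient \<open>M\<close> exceeds the direct one by sin \<alpha> sin
  \<beta>. So the claim is that the gain of the depth of \<beta> over sin \<beta>, weighted by sin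
  \<alpha>, is at most \<open>k * M\<close>.\<close>

lemma nonconvex_depth_le_reflected:
  assumes "0 < \<alpha>" "\<alpha> \<le> \<beta>" "\<alpha> + \<beta> \<le> pi" "pi \<le> \<theta>" "\<theta> < 2 * pi"
  shows "(sin ((\<beta> - \<alpha>) / 2))\<^sup>2 + sector_depth \<theta> \<alpha> * sector_depth \<theta> \<beta>
    \<le> (1 - cos (\<theta> / 2)) * (sin ((\<alpha> + \<beta>) / 2))\<^sup>2"
proof -
  define k where "k = - cos (\<theta> / 2)"
  define M where "M = (sin ((\<alpha> + \<beta>) / 2))\<^sup>2"
  have k: "k = sin (\<theta> / 2 - pi / 2)" "0 \<le> k"
    unfolding k_def minus_cos_half_eq using assms by (auto intro!: sin_ge_zero)
  have M: "(sin ((\<beta> - \<alpha>) / 2))\<^sup>2 = M - sin \<alpha> * sin \<beta>" "0 \<le> M"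
    unfolding M_def sin_times_sin_half by simp_all
  have \<alpha>: "sector_depth \<theta> \<alpha> = sin \<alpha>" "0 \<le> sin \<alpha>"
    using assms by (auto simp: sector_depth_def min_def intro!: arg_cong[of _ _ sin] sin_ge_zero)
  have "sin \<alpha> * (sector_depth \<theta> \<beta> - sin \<beta>) \<le> k * M"
  proof -
    \<comment> \<open>In the first case nothing is gained; in the second the far ray is nearest, in
      the third the vertex.\<close>
    consider "\<beta> \<le> pi / 2" | "pi / 2 < \<beta>" "\<theta> - \<beta> \<le> pi / 2" | "pi / 2 < \<beta>" "pi / 2 < \<theta> - \<beta>"
      by linarith
    then show ?thesis
    proof cases
      case 1
      then have "sector_depth \<theta> \<beta> \<le> sin \<beta>"
        unfolding sector_depth_def using assms
        by (intro sin_monotone_2pi_le) (auto simp: min_def)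
      then have "sin \<alpha> * (sector_depth \<theta> \<beta> - sin \<beta>) \<le> 0"
        using \<alpha>(2) by (simp add: mult_nonneg_nonpos)
      also have "0 \<le> k * M" using k M by simp
      finally show ?thesis .
    next
      case 2
      then have "sector_depth \<theta> \<beta> = sin (\<theta> - \<beta>)"
        using assms by (auto simp: sector_depth_def min_def intro!: arg_cong[of _ _ sin])
      then have "sin \<alpha> * (sector_depth \<theta> \<beta> - sin \<beta>) = k * (2 * sin \<alpha> * sin (\<beta> - \<theta> / 2))"
        using sin_diff_half[of \<beta> \<theta>] by (simp add: k_def algebra_simps)
      also have "\<dots> \<le> k * M"
        unfolding M_def using k(2) 2 assms
        by (intro mult_left_mono double_sin_times_sin_le) auto
      finally show ?thesis .
    next
      case 3
      \<comment> \<open>Chosen so that the gain 1 - sin \<beta> is 2 sin^2 e: one factor sin e is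
        bounded by \<open>k\<close>, the other goes into
        \<open>double_sin_times_sin_le\<close>.\<close>
      define e where "e = (\<beta> - pi / 2) / 2"
      have "2 * e = \<beta> - pi / 2" by (simp only: e_def times_divide_eq_right nonzero_mult_div_cancel_left)
      then have "\<beta> = 2 * e + pi / 2" by (simp only: diff_add_cancel)
      then have "sin \<beta> = 1 - 2 * (sin e)\<^sup>2"
        by (simp add: sin_add cos_double_sin)
      moreover have "sector_depth \<theta> \<beta> = 1"
        using 3 by (simp add: sector_depth_def min_def)
      ultimately have "sin \<alpha> * (sector_depth \<theta> \<beta> - sin \<beta>) = sin e * (2 * sin \<alpha> * sin e)"
        by (simp add: power2_eq_square)
      also have "\<dots> \<le> sin e * M"
        unfolding M_def using 3 assms
        by (intro mult_left_mono double_sin_times_sin_le) (auto simp: e_def intro!: sin_ge_zero)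
      also have "\<dots> \<le> k * M"
        unfolding k(1) using 3 assms M(2)
        by (intro mult_right_mono sin_monotone_2pi_le) (auto simp: e_def field_simps)
      finally show ?thesis .
    qed
  qed
  then have "M - sin \<alpha> * sin \<beta> + sin \<alpha> * sector_depth \<theta> \<beta> \<le> (1 + k) * M"
    by (simp add: algebra_simps)
  then show ?thesis
    unfolding M(1) \<alpha>(1) by (simp add: k_def M_def)
qed

text \<open>A product of two sines is at most the squared sine of the mean angle \<kappa>. Bounding
  the angle of the first point by \<alpha> and that of the second by \<theta> - \<beta> bounds
  \<kappa>.\<close>

lemma depth_product_le:
  assumes "0 < \<alpha>" "\<alpha> < \<theta>" "0 < \<beta>" "\<beta> < \<theta>"
  obtains \<kappa> where "0 \<le> \<kappa>" "\<kappa> \<le> pi / 2" "\<kappa> \<le> \<theta> / 2 - (\<beta> - \<alpha>) / 2"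
    "sector_depth \<theta> \<alpha> * sector_depth \<theta> \<beta> \<le> (sin \<kappa>)\<^sup>2"
proof
  define \<mu> \<nu> where "\<mu> = min (min \<alpha> (\<theta> - \<alpha>)) (pi / 2)" and "\<nu> = min (min \<beta> (\<theta> - \<beta>)) (pi / 2)"
  have "0 < \<mu>" "0 < \<nu>" "\<mu> \<le> pi / 2" "\<nu> \<le> pi / 2" "\<mu> \<le> \<alpha>" "\<nu> \<le> \<theta> - \<beta>"
    using assms by (simp_all add: \<mu>_def \<nu>_def del: min_less_iff_conj min_le_iff_disj) (simp_all add: min_def)
  then show "0 \<le> (\<mu> + \<nu>) / 2" "(\<mu> + \<nu>) / 2 \<le> pi / 2" "(\<mu> + \<nu>) / 2 \<le> \<theta> / 2 - (\<beta> - \<alpha>) / 2"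
    by (auto simp: field_simps)
  show "sector_depth \<theta> \<alpha> * sector_depth \<theta> \<beta> \<le> (sin ((\<mu> + \<nu>) / 2))\<^sup>2"
    unfolding sector_depth_def \<mu>_def[symmetric] \<nu>_def[symmetric] sin_times_sin_half by simp
qed

text \<open>The excess over 1 is at most sin^2 \<kappa> - cos^2 n, which factors into the sines of a
  sum and of a difference; the latter is at most sin(\<theta>/2 - pi/2) = -cos(\<theta>/2).\<close>

lemma nonconvex_depth_le_origin:
  assumes "0 < \<alpha>" "\<alpha> \<le> \<beta>" "\<beta> < \<theta>" "\<beta> - \<alpha> \<le> pi" "pi \<le> \<theta>" "\<theta> < 2 * pi"
  shows "(sin ((\<beta> - \<alpha>) / 2))\<^sup>2 + sector_depth \<theta> \<alpha> * sector_depth \<theta> \<beta> \<le> 1 - cos (\<theta> / 2)"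
proof -
  define n where "n = (\<beta> - \<alpha>) / 2"
  have n: "0 \<le> n" "n \<le> pi / 2" unfolding n_def using assms by auto
  obtain \<kappa> where \<kappa>: "0 \<le> \<kappa>" "\<kappa> \<le> pi / 2" "\<kappa> \<le> \<theta> / 2 - n"
    "sector_depth \<theta> \<alpha> * sector_depth \<theta> \<beta> \<le> (sin \<kappa>)\<^sup>2"
    unfolding n_def by (rule depth_product_le[of \<alpha> \<theta> \<beta>]) (use assms in auto)
  have "sin (pi / 2 - n) = cos n" by (simp add: sin_diff)
  have "(sin \<kappa>)\<^sup>2 - (sin (pi / 2 - n))\<^sup>2 \<le> sin (\<theta> / 2 - pi / 2)"
  proof (cases "\<kappa> \<le> pi / 2 - n")
    case True
    then have "(sin \<kappa>)\<^sup>2 \<le> (sin (pi / 2 - n))\<^sup>2"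
      using \<kappa> n by (intro power_mono sin_monotone_2pi_le sin_ge_zero) auto
    moreover have "0 \<le> sin (\<theta> / 2 - pi / 2)"
      using assms by (intro sin_ge_zero) auto
    ultimately show ?thesis by linarith
  next
    case False
    then have "0 \<le> sin (\<kappa> - (pi / 2 - n))" "sin (\<kappa> - (pi / 2 - n)) \<le> sin (\<theta> / 2 - pi / 2)"
      using \<kappa> n assms by (auto intro!: sin_ge_zero sin_monotone_2pi_le)
    moreover from this(1) have "sin (\<kappa> + (pi / 2 - n)) * sin (\<kappa> - (pi / 2 - n))
        \<le> 1 * sin (\<kappa> - (pi / 2 - n))"
      by (intro mult_right_mono) auto
    ultimately show ?thesis
      unfolding sin_squared_minus by linarith
  qed
  then show ?thesis
    using \<kappa>(4) minus_cos_half_eq[of \<theta>] unfolding \<open>sin (pi / 2 - n) = cos n\<close> n_def[symmetric]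
    by (simp add: cos_squared_eq)
qed

text \<open>In terms of q and v the claim follows from sin^2 q \<le> sin(q + v) cos^2 v. One factor
  sin q is bounded through the product-to-sum formula, the other through q \<le> pi/2 - v.\<close>

lemma nonconvex_depth_le_dist:
  assumes "0 < \<alpha>" "\<beta> < \<theta>" "pi \<le> \<beta> - \<alpha>" "\<theta> < 2 * pi"
  shows "sector_depth \<theta> \<alpha> * sector_depth \<theta> \<beta> \<le> - cos (\<theta> / 2) * (sin ((\<beta> - \<alpha>) / 2))\<^sup>2"
proof -
  define v where "v = (\<beta> - \<alpha>) / 2 - pi / 2"
  define q where "q = \<theta> / 2 - (\<beta> - \<alpha>) / 2"
  have q: "0 \<le> q" "0 \<le> v" "q + v \<le> pi / 2" "\<theta> / 2 - pi / 2 = q + v"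
    unfolding q_def v_def using assms by (auto simp: field_simps)
  have "(\<beta> - \<alpha>) / 2 = v + pi / 2" by (simp add: v_def)
  then have n: "sin ((\<beta> - \<alpha>) / 2) = cos v" by (simp only: sin_add) simp
  obtain \<kappa> where \<kappa>: "0 \<le> \<kappa>" "\<kappa> \<le> pi / 2" "\<kappa> \<le> q"
    "sector_depth \<theta> \<alpha> * sector_depth \<theta> \<beta> \<le> (sin \<kappa>)\<^sup>2"
    unfolding q_def by (rule depth_product_le[of \<alpha> \<theta> \<beta>]) (use assms pi_gt_zero in linarith)+
  note \<kappa>(4)
  also have "(sin \<kappa>)\<^sup>2 \<le> (sin q)\<^sup>2"
    using \<kappa> q by (intro power_mono sin_monotone_2pi_le sin_ge_zero) auto
  also have "\<dots> = sin q * sin q"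
    by (simp add: power2_eq_square)
  also have "\<dots> \<le> (sin (q + v) * cos v) * cos v"
  proof (rule mult_mono)
    have "sin q \<le> sin (q + v + v)"
      using q by (intro sin_le_sin_between) auto
    moreover have "2 * (sin (q + v) * cos v) = sin (q + v + v) + sin (q + v - v)"
      unfolding sin_add[of "q + v" v] sin_diff[of "q + v" v] by simp
    ultimately show "sin q \<le> sin (q + v) * cos v" by simp
    show "0 \<le> sin (q + v) * cos v"
      using q by (intro mult_nonneg_nonneg sin_ge_zero cos_ge_zero) auto
    have "sin q \<le> sin (pi / 2 - v)"
      using q by (intro sin_monotone_2pi_le) auto
    then show "sin q \<le> cos v" by (simp add: sin_diff)
  qed (use q in \<open>auto intro!: sin_ge_zero\<close>)
  finally show ?thesis
    unfolding minus_cos_half_eq q(4) n by (simp add: power2_eq_square)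
qed

section \<open>Reduction by symmetry\<close>

lemma sector_pair_wlog:
  fixes a b \<alpha> \<beta> \<theta> :: real
  assumes "0 < a" "0 < b" "0 < \<alpha>" "\<alpha> < \<theta>" "0 < \<beta>" "\<beta> < \<theta>"
    and ordered: "\<And>a b \<alpha> \<beta>. \<lbrakk>0 < a; 0 < b; 0 < \<alpha>; \<alpha> < \<theta>; 0 < \<beta>; \<beta> < \<theta>; \<alpha> \<le> \<beta>; \<alpha> + \<beta> \<le> \<theta>\<rbrakk>
      \<Longrightarrow> P a b \<alpha> \<beta>"
    and swap: "\<And>a b \<alpha> \<beta>. P a b \<alpha> \<beta> \<Longrightarrow> P b a \<beta> \<alpha>"
    and reflect: "\<And>a b \<alpha> \<beta>. P a b (\<theta> - \<alpha>) (\<theta> - \<beta>) \<Longrightarrow> P a b \<alpha> \<beta>"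
  shows "P a b \<alpha> \<beta>"
proof -
  have le: "P a b \<alpha> \<beta>" if "\<alpha> + \<beta> \<le> \<theta>" "0 < a" "0 < b" "0 < \<alpha>" "\<alpha> < \<theta>" "0 < \<beta>" "\<beta> < \<theta>" for a b \<alpha> \<beta>
  proof (cases "\<alpha> \<le> \<beta>")
    case True
    with that show ?thesis by (intro ordered)
  next
    case False
    with that have "P b a \<beta> \<alpha>" by (intro ordered) linarith+
    then show ?thesis by (rule swap)
  qed
  show ?thesis
  proof (cases "\<alpha> + \<beta> \<le> \<theta>")
    case True
    with assms(1-6) show ?thesis by (intro le)
  next
    case False
    with assms(1-6) have "P a b (\<theta> - \<alpha>) (\<theta> - \<beta>)" by (intro le) linarith+
    then show ?thesis by (rule reflect)
  qed
qed

definition pf_denominator :: "complex set \<Rightarrow> complex \<Rightarrow> complex \<Rightarrow> real" where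
  "pf_denominator G x y = (dist x y)\<^sup>2 + 4 * bdist G x * bdist G y"

lemma pf_denominator_commute: "pf_denominator G x y = pf_denominator G y x"
  by (simp add: pf_denominator_def dist_commute)

lemma pf_denominator_sector:
  assumes "0 < a" "0 < b" "0 < \<alpha>" "\<alpha> < \<theta>" "0 < \<beta>" "\<beta> < \<theta>" "\<theta> < 2 * pi"
  shows "pf_denominator (sector \<theta>) (rcis a \<alpha>) (rcis b \<beta>)
    = (a - b)\<^sup>2 + 4 * a * b * ((sin ((\<beta> - \<alpha>) / 2))\<^sup>2 + sector_depth \<theta> \<alpha> * sector_depth \<theta> \<beta>)"
  unfolding pf_denominator_def dist_rcis_half_angle using assms
  by (simp add: bdist_sector algebra_simps)

lemma pf_denominator_sector_reflect:
  assumes "0 < a" "0 < b" "0 < \<alpha>" "\<alpha> < \<theta>" "0 < \<beta>" "\<beta> < \<theta>" "\<theta> < 2 * pi"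
  shows "pf_denominator (sector \<theta>) (rcis a (\<theta> - \<alpha>)) (rcis b (\<theta> - \<beta>))
    = pf_denominator (sector \<theta>) (rcis a \<alpha>) (rcis b \<beta>)"
proof -
  have "dist (rcis a (\<theta> - \<alpha>)) (rcis b (\<theta> - \<beta>)) = dist (rcis a \<alpha>) (rcis b \<beta>)"
    using cos_minus[of "\<alpha> - \<beta>"] by (intro dist_rcis_cong) simp
  then show ?thesis
    using assms by (simp add: pf_denominator_def bdist_sector sector_depth_reflect)
qed

text \<open>Passing to the mirror image in the real axis turns the angle \<beta> - \<alpha> into
  \<alpha> + \<beta>.\<close>

lemma reflected_dist_half_angle:
  "(dist (rcis a \<alpha>) (rcis b \<beta>))\<^sup>2 + 4 * (a * sin \<alpha>) * (b * sin \<beta>)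
    = (a - b)\<^sup>2 + 4 * a * b * (sin ((\<alpha> + \<beta>) / 2))\<^sup>2"
proof -
  have "4 * (a * sin \<alpha>) * (b * sin \<beta>) = 4 * a * b * (sin \<alpha> * sin \<beta>)"
    by simp
  then show ?thesis
    unfolding dist_rcis_half_angle sin_times_sin_half by (simp add: algebra_simps)
qed

text \<open>Lifts a comparison of coefficients to the full expressions, with q = (a - b)^2 and w =
  4ab; c \<ge> 1 takes care of the common term.\<close>

lemma le_scaled_sum:
  fixes q w :: real
  assumes "A \<le> c * B" "0 \<le> q" "0 \<le> w" "1 \<le> c"
  shows "q + w * A \<le> c * (q + w * B)"
proof -
  have "w * A \<le> w * (c * B)" "1 * q \<le> c * q"
    using mult_left_mono[OF assms(1,3)] mult_right_mono[OF assms(4,2)] by simp_all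
  then show ?thesis by (simp add: algebra_simps)
qed

lemma sectorE2:
  assumes "x \<in> sector \<theta>" "y \<in> sector \<theta>"
  obtains a b \<alpha> \<beta> where "x = rcis a \<alpha>" "y = rcis b \<beta>" "0 < a" "0 < b"
    "0 < \<alpha>" "\<alpha> < \<theta>" "0 < \<beta>" "\<beta> < \<theta>"
  using sectorE[OF assms(1)] sectorE[OF assms(2)] by metis

lemma sector_pair_cases:
  assumes "x \<in> sector \<theta>" "y \<in> sector \<theta>" "\<theta> < 2 * pi"
    and ordered: "\<And>a b \<alpha> \<beta>. \<lbrakk>0 < a; 0 < b; 0 < \<alpha>; \<alpha> < \<theta>; 0 < \<beta>; \<beta> < \<theta>; \<alpha> \<le> \<beta>; \<alpha> + \<beta> \<le> \<theta>\<rbrakk>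
      \<Longrightarrow> R (pf_denominator (sector \<theta>) (rcis a \<alpha>) (rcis b \<beta>)) (detour (sector \<theta>) (rcis a \<alpha>) (rcis b \<beta>))"
  shows "R (pf_denominator (sector \<theta>) x y) (detour (sector \<theta>) x y)"
proof -
  obtain a b \<alpha> \<beta> where xy: "x = rcis a \<alpha>" "y = rcis b \<beta>" "0 < a" "0 < b"
    "0 < \<alpha>" "\<alpha> < \<theta>" "0 < \<beta>" "\<beta> < \<theta>"
    using sectorE2[OF assms(1,2)] .
  \<comment> \<open>The range conditions are built into \<open>P\<close> because the reflection
    identity for \<open>pf_denominator\<close> is available only for arguments inside the
    sector.\<close>
  define P where "P a b \<alpha> \<beta> \<longleftrightarrow> (0 < a \<and> 0 < b \<and> 0 < \<alpha> \<and> \<alpha> < \<theta> \<and> 0 < \<beta> \<and> \<beta> < \<theta> \<and>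
    R (pf_denominator (sector \<theta>) (rcis a \<alpha>) (rcis b \<beta>)) (detour (sector \<theta>) (rcis a \<alpha>) (rcis b \<beta>)))"
    for a b \<alpha> \<beta>
  have "P a b \<alpha> \<beta>"
    using xy(3-8)
  proof (rule sector_pair_wlog)
    fix a b \<alpha> \<beta>
    show "P a b \<alpha> \<beta> \<Longrightarrow> P b a \<beta> \<alpha>"
      by (simp add: P_def pf_denominator_commute[of _ "rcis b \<beta>"] detour_commute[of _ "rcis b \<beta>"])
    show "P a b \<alpha> \<beta>" if "P a b (\<theta> - \<alpha>) (\<theta> - \<beta>)"
      using that assms(3) detour_sector_reflect[of \<theta> a \<alpha> b \<beta>]
        pf_denominator_sector_reflect[of a b \<alpha> \<theta> \<beta>] by (auto simp: P_def)
  qed (auto simp: P_def intro: ordered)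
  then show ?thesis by (simp add: P_def xy)
qed

section \<open>Squared detour against point pair denominator\<close>

lemma convex_pf_le_detour:
  assumes "\<theta> \<le> pi" "x \<in> sector \<theta>" "y \<in> sector \<theta>"
  shows "pf_denominator (sector \<theta>) x y \<le> (detour (sector \<theta>) x y)\<^sup>2"
proof -
  obtain a b \<alpha> \<beta> where xy: "x = rcis a \<alpha>" "y = rcis b \<beta>" "0 < a" "0 < b"
    "0 < \<alpha>" "\<alpha> < \<theta>" "0 < \<beta>" "\<beta> < \<theta>"
    using sectorE2[OF assms(2,3)] .
  then have "\<theta> < 2 * pi" using assms by linarith
  with xy convex_detour_ge[of \<theta> a b \<alpha> \<beta>] assms show ?thesis
    by (simp add: pf_denominator_def bdist_sector)
qed

lemma convex_detour_le_pf:
  assumes "\<theta> \<le> pi" "x \<in> sector \<theta>" "y \<in> sector \<theta>"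
  shows "(detour (sector \<theta>) x y)\<^sup>2 \<le> (1 + cos (\<theta> / 2)) * pf_denominator (sector \<theta>) x y"
proof (rule sector_pair_cases[OF assms(2,3)])
  have "0 < \<theta>" using sectorE[OF assms(2)] by (metis less_trans)
  then show \<theta>: "\<theta> < 2 * pi" using assms by linarith
  fix a b \<alpha> \<beta> :: real
  assume *: "0 < a" "0 < b" "0 < \<alpha>" "\<alpha> < \<theta>" "0 < \<beta>" "\<beta> < \<theta>" "\<alpha> \<le> \<beta>" "\<alpha> + \<beta> \<le> \<theta>"
  have "(detour (sector \<theta>) (rcis a \<alpha>) (rcis b \<beta>))\<^sup>2 \<le> (a - b)\<^sup>2 + 4 * a * b * (sin ((\<alpha> + \<beta>) / 2))\<^sup>2"
    using detour_le_crossing[of \<theta> a b \<alpha> \<beta>] * \<theta> \<open>0 < \<theta>\<close> assms(1)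
    unfolding reflected_dist_half_angle by simp
  also have "\<dots> \<le> (1 + cos (\<theta> / 2)) * pf_denominator (sector \<theta>) (rcis a \<alpha>) (rcis b \<beta>)"
    unfolding pf_denominator_sector[OF *(1-6) \<theta>] using * assms(1) cos_half_nonneg[of \<theta>]
    by (intro le_scaled_sum convex_depth_bound) auto
  finally show "(detour (sector \<theta>) (rcis a \<alpha>) (rcis b \<beta>))\<^sup>2
    \<le> (1 + cos (\<theta> / 2)) * pf_denominator (sector \<theta>) (rcis a \<alpha>) (rcis b \<beta>)" .
qed

lemma square_add_eq: "(a + b)\<^sup>2 = (a - b)\<^sup>2 + 4 * a * b" for a b :: real
  by (simp add: power2_eq_square algebra_simps)

lemma nonconvex_detour_le_pf:
  assumes "pi \<le> \<theta>" "\<theta> < 2 * pi" "x \<in> sector \<theta>" "y \<in> sector \<theta>"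
  shows "(detour (sector \<theta>) x y)\<^sup>2 \<le> pf_denominator (sector \<theta>) x y"
proof (rule sector_pair_cases[OF assms(3,4,2)])
  have "0 < \<theta>" using assms pi_gt_zero by linarith
  fix a b \<alpha> \<beta> :: real
  assume *: "0 < a" "0 < b" "0 < \<alpha>" "\<alpha> < \<theta>" "0 < \<beta>" "\<beta> < \<theta>" "\<alpha> \<le> \<beta>" "\<alpha> + \<beta> \<le> \<theta>"
  let ?L = "detour (sector \<theta>) (rcis a \<alpha>) (rcis b \<beta>)"
  have "dist (rcis a \<alpha>) (rcis b \<beta>) \<le> ?L"
    using zero_in_rays[of \<theta>] by (intro dist_le_detour) (auto simp: frontier_sector \<open>0 < \<theta>\<close> assms(2))
  then have L: "0 \<le> ?L"
    using zero_le_dist[of "rcis a \<alpha>" "rcis b \<beta>"] by linarith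
  have ab: "0 \<le> 4 * a * b" using * by simp
  note pf = pf_denominator_sector[OF *(1-6) assms(2)]
  consider "\<alpha> + \<beta> \<le> pi" | "pi \<le> \<alpha> + \<beta>" "\<beta> - \<alpha> \<le> pi" | "pi \<le> \<beta> - \<alpha>" by linarith
  then show "?L\<^sup>2 \<le> pf_denominator (sector \<theta>) (rcis a \<alpha>) (rcis b \<beta>)"
  proof cases
    case 1
    have "?L\<^sup>2 \<le> (a - b)\<^sup>2 + 4 * a * b * (sin ((\<alpha> + \<beta>) / 2))\<^sup>2"
      using detour_le_crossing[of \<theta> a b \<alpha> \<beta>] * \<open>0 < \<theta>\<close> assms(2) 1
      unfolding reflected_dist_half_angle by simp
    also have "\<dots> \<le> pf_denominator (sector \<theta>) (rcis a \<alpha>) (rcis b \<beta>)"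
      unfolding pf using nonconvex_depth_ge_sin[of \<alpha> \<beta> \<theta>] * 1 assms(1) ab
      unfolding sin_times_sin_half by (intro add_left_mono mult_left_mono) auto
    finally show ?thesis .
  next
    case 2
    have "?L\<^sup>2 \<le> (a + b)\<^sup>2"
      using detour_le_add[of \<theta> a b \<alpha> \<beta>] * \<open>0 < \<theta>\<close> assms(2) L by (intro power_mono) auto
    also have "\<dots> = (a - b)\<^sup>2 + 4 * a * b * 1"
      by (simp add: square_add_eq)
    also have "\<dots> \<le> pf_denominator (sector \<theta>) (rcis a \<alpha>) (rcis b \<beta>)"
      unfolding pf using nonconvex_depth_ge_cos[of \<alpha> \<beta> \<theta>] * 2 ab
      unfolding cos_squared_eq by (intro add_left_mono mult_left_mono) auto
    finally show ?thesis .
  next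
    case 3
    have "?L\<^sup>2 \<le> (dist (rcis a \<alpha>) (rcis b \<beta>))\<^sup>2"
      using detour_le_dist[of \<theta> a b \<alpha> \<beta>] * \<open>0 < \<theta>\<close> assms(2) 3 L by (intro power_mono) auto
    also have "\<dots> \<le> pf_denominator (sector \<theta>) (rcis a \<alpha>) (rcis b \<beta>)"
      unfolding pf_denominator_def by (simp add: bdist_def infdist_nonneg)
    finally show ?thesis .
  qed
qed

text \<open>Each case pairs a lower bound for the detour with the depth bound for the same range of
  angles.\<close>

lemma nonconvex_pf_le_detour:
  assumes "pi \<le> \<theta>" "\<theta> < 2 * pi" "x \<in> sector \<theta>" "y \<in> sector \<theta>"
  shows "pf_denominator (sector \<theta>) x y \<le> (1 - cos (\<theta> / 2)) * (detour (sector \<theta>) x y)\<^sup>2"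
proof (rule sector_pair_cases[OF assms(3,4,2)])
  have "0 < \<theta>" using assms pi_gt_zero by linarith
  fix a b \<alpha> \<beta> :: real
  assume *: "0 < a" "0 < b" "0 < \<alpha>" "\<alpha> < \<theta>" "0 < \<beta>" "\<beta> < \<theta>" "\<alpha> \<le> \<beta>" "\<alpha> + \<beta> \<le> \<theta>"
  let ?L = "detour (sector \<theta>) (rcis a \<alpha>) (rcis b \<beta>)"
  have ab: "0 \<le> 4 * a * b" using * by simp
  have k: "1 \<le> 1 - cos (\<theta> / 2)"
    using cos_nonpos[of "\<theta> / 2"] assms by simp
  note pf = pf_denominator_sector[OF *(1-6) assms(2)]
  consider "\<alpha> + \<beta> \<le> pi" | "pi \<le> \<alpha> + \<beta>" "\<beta> - \<alpha> \<le> pi" | "pi \<le> \<beta> - \<alpha>" by linarith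
  then show "pf_denominator (sector \<theta>) (rcis a \<alpha>) (rcis b \<beta>) \<le> (1 - cos (\<theta> / 2)) * ?L\<^sup>2"
  proof cases
    case 1
    have "pf_denominator (sector \<theta>) (rcis a \<alpha>) (rcis b \<beta>)
        \<le> (1 - cos (\<theta> / 2)) * ((a - b)\<^sup>2 + 4 * a * b * (sin ((\<alpha> + \<beta>) / 2))\<^sup>2)"
      unfolding pf using * 1 assms ab k by (intro le_scaled_sum nonconvex_depth_le_reflected) auto
    also have "\<dots> \<le> (1 - cos (\<theta> / 2)) * ?L\<^sup>2"
    proof (rule mult_left_mono)
      have "(dist (rcis a (2 * 0 - \<alpha>)) (rcis b \<beta>))\<^sup>2 \<le> ?L\<^sup>2"
        using nonconvex_detour_ge_reflected[of \<theta> a b \<alpha> \<beta>] * assms by (intro power_mono) auto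
      then show "(a - b)\<^sup>2 + 4 * a * b * (sin ((\<alpha> + \<beta>) / 2))\<^sup>2 \<le> ?L\<^sup>2"
        unfolding reflected_dist_squared reflected_dist_half_angle[symmetric] by simp
    qed (use k in simp)
    finally show ?thesis .
  next
    case 2
    have "pf_denominator (sector \<theta>) (rcis a \<alpha>) (rcis b \<beta>)
        \<le> (1 - cos (\<theta> / 2)) * ((a - b)\<^sup>2 + 4 * a * b * 1)"
      unfolding pf using * 2 assms ab k nonconvex_depth_le_origin[of \<alpha> \<beta> \<theta>]
      by (intro le_scaled_sum) auto
    also have "\<dots> \<le> (1 - cos (\<theta> / 2)) * ?L\<^sup>2"
    proof (rule mult_left_mono)
      have "(a + b)\<^sup>2 \<le> ?L\<^sup>2"
        using nonconvex_detour_ge_add[of \<theta> a b \<alpha> \<beta>] * 2 assms by (intro power_mono) auto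
      then show "(a - b)\<^sup>2 + 4 * a * b * 1 \<le> ?L\<^sup>2"
        by (simp add: square_add_eq)
    qed (use k in simp)
    finally show ?thesis .
  next
    case 3
    have "pf_denominator (sector \<theta>) (rcis a \<alpha>) (rcis b \<beta>)
        \<le> (1 - cos (\<theta> / 2)) * ((a - b)\<^sup>2 + 4 * a * b * (sin ((\<beta> - \<alpha>) / 2))\<^sup>2)"
      unfolding pf using * 3 assms ab k nonconvex_depth_le_dist[of \<alpha> \<beta> \<theta>]
      by (intro le_scaled_sum) (auto simp: algebra_simps)
    also have "\<dots> \<le> (1 - cos (\<theta> / 2)) * ?L\<^sup>2"
    proof (rule mult_left_mono)
      have "frontier (sector \<theta>) \<noteq> {}"
        using zero_in_rays[of \<theta>] by (auto simp: frontier_sector \<open>0 < \<theta>\<close> assms(2))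
      then show "(a - b)\<^sup>2 + 4 * a * b * (sin ((\<beta> - \<alpha>) / 2))\<^sup>2 \<le> ?L\<^sup>2"
        unfolding dist_rcis_half_angle[symmetric] by (intro power_mono dist_le_detour) auto
    qed (use k in simp)
    finally show ?thesis .
  qed
qed

section \<open>The inequalities and their sharpness\<close>

lemma s_metric_detour: "s_metric G x y = dist x y / detour G x y"
  by (simp add: s_metric_def detour_def)

lemma p_fun_pf_denominator: "p_fun G x y = dist x y / sqrt (pf_denominator G x y)"
  by (simp add: p_fun_def pf_denominator_def)

lemma divide_le_scaled:
  fixes t A B c :: real
  assumes "0 < A" "0 < B" "0 \<le> t" "B \<le> c * A"
  shows "t / A \<le> c * (t / B)"
proof -
  have "t * B \<le> t * (c * A)" using assms by (intro mult_left_mono)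
  then show ?thesis using assms(1,2) by (simp add: field_simps)
qed

lemma scaled_le_divide:
  fixes t A B c :: real
  assumes "0 < A" "0 < B" "0 \<le> t" "c * A \<le> B"
  shows "c * (t / B) \<le> t / A"
proof -
  have "t * (c * A) \<le> t * B" using assms by (intro mult_left_mono)
  then show ?thesis using assms(1,2) by (simp add: field_simps)
qed

section \<open>Comparison of the three quantities in an arbitrary set\<close>

lemma bdist_nonneg: "0 \<le> bdist G x"
  by (simp add: bdist_def infdist_nonneg)

lemma bdist_lipschitz: "bdist G x \<le> bdist G y + dist x y"
  unfolding bdist_def by (rule infdist_triangle)

lemma denominators_pos:
  assumes "x \<noteq> y"
  shows "0 < dist x y + 2 * min (bdist G x) (bdist G y)" "0 < pf_denominator G x y"
  using assms bdist_nonneg[of G x] bdist_nonneg[of G y]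
  by (auto simp: pf_denominator_def intro!: add_pos_nonneg)

lemma j_star_pos: "x \<noteq> y \<Longrightarrow> 0 < j_star G x y"
  unfolding j_star_def using denominators_pos(1) by (intro divide_pos_pos) auto

lemma p_fun_pos: "x \<noteq> y \<Longrightarrow> 0 < p_fun G x y"
  unfolding p_fun_pf_denominator using denominators_pos(2) by (intro divide_pos_pos) auto

text \<open>The boundary distance is 1-Lipschitz, so with t = |x - y| and m the smaller distance the
  larger one is at most m + t, and t^2 + 4m(m + t) = (t + 2m)^2.\<close>

lemma pf_denominator_le_square:
  "pf_denominator G x y \<le> (dist x y + 2 * min (bdist G x) (bdist G y))\<^sup>2"
proof -
  have *: "t\<^sup>2 + 4 * m * n \<le> (t + 2 * m)\<^sup>2" if "0 \<le> m" "n \<le> m + t" for t m n :: real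
  proof -
    have "m * n \<le> m * (m + t)" using that by (intro mult_left_mono)
    then show ?thesis by (simp add: power2_eq_square algebra_simps)
  qed
  show ?thesis
    using *[of "bdist G x" "bdist G y" "dist x y"] *[of "bdist G y" "bdist G x" "dist x y"]
      bdist_nonneg[of G x] bdist_nonneg[of G y] bdist_lipschitz[of G x y] bdist_lipschitz[of G y x]
    by (auto simp: pf_denominator_def min_def dist_commute mult.assoc mult.commute[of "bdist G x"])
qed

text \<open>(t + 2m)^2 \<le> 2(t^2 + 4m^2), with equality for t = 2m; the extremal pairs for the
  constant sqrt 2 are chosen accordingly.\<close>

lemma square_le_pf_denominator:
  "(dist x y + 2 * min (bdist G x) (bdist G y))\<^sup>2 \<le> 2 * pf_denominator G x y"
proof -
  define m where "m = min (bdist G x) (bdist G y)"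
  have "m * m \<le> bdist G x * bdist G y"
    unfolding m_def using bdist_nonneg[of G] by (intro mult_mono) auto
  moreover have "0 \<le> (dist x y - 2 * m)\<^sup>2" by simp
  ultimately show ?thesis
    unfolding pf_denominator_def m_def[symmetric] by (simp add: power2_eq_square algebra_simps)
qed

lemma j_star_le_p_fun: "j_star G x y \<le> p_fun G x y"
\<comment> \<open>For x = y both sides vanish whatever the denominators, so positivity matters only
  for distinct points.\<close>
proof (cases "x = y")
  case False
  have "sqrt (pf_denominator G x y) \<le> 1 * (dist x y + 2 * min (bdist G x) (bdist G y))"
    using real_sqrt_le_mono[OF pf_denominator_le_square[of G x y]] denominators_pos(1)[OF False, of G]
    by simp
  with denominators_pos[OF False, of G] show ?thesis
    unfolding j_star_def p_fun_pf_denominator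
    using divide_le_scaled[of "dist x y + 2 * min (bdist G x) (bdist G y)" "sqrt (pf_denominator G x y)" "dist x y" 1]
    by simp
qed (simp add: j_star_def p_fun_def)

lemma p_fun_le_j_star: "p_fun G x y \<le> sqrt 2 * j_star G x y"
proof (cases "x = y")
  case False
  have "dist x y + 2 * min (bdist G x) (bdist G y) \<le> sqrt 2 * sqrt (pf_denominator G x y)"
    using real_le_rsqrt[OF square_le_pf_denominator[of x y G]] by (simp add: real_sqrt_mult)
  with denominators_pos[OF False, of G] show ?thesis
    unfolding j_star_def p_fun_pf_denominator by (intro divide_le_scaled) auto
qed (simp add: j_star_def p_fun_def)

lemma detour_pos: "frontier G \<noteq> {} \<Longrightarrow> x \<noteq> y \<Longrightarrow> 0 < detour G x y"
  using dist_le_detour[of G x y] zero_less_dist_iff[of x y] by linarith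

lemma j_star_le_s_metric:
  assumes "frontier G \<noteq> {}"
  shows "j_star G x y \<le> s_metric G x y"
proof (cases "x = y")
  case False
  with denominators_pos(1)[OF False, of G] detour_pos[OF assms False] detour_le_bdist[OF assms, of x y]
  show ?thesis
    unfolding j_star_def s_metric_detour by (intro divide_left_mono) auto
qed (simp add: j_star_def s_metric_def)

lemma s_metric_le_p_fun:
  assumes "frontier G \<noteq> {}" "0 \<le> c" "pf_denominator G x y \<le> c\<^sup>2 * (detour G x y)\<^sup>2"
  shows "s_metric G x y \<le> c * p_fun G x y"
proof (cases "x = y")
  case False
  have "sqrt (pf_denominator G x y) \<le> sqrt ((c * detour G x y)\<^sup>2)"
    using assms(3) by (simp add: power_mult_distrib)
  with denominators_pos[OF False, of G] detour_pos[OF assms(1) False] assms(2) show ?thesis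
    unfolding s_metric_detour p_fun_pf_denominator by (intro divide_le_scaled) auto
qed (simp add: s_metric_def p_fun_def)

lemma p_fun_le_s_metric:
  assumes "frontier G \<noteq> {}" "0 \<le> c" "(detour G x y)\<^sup>2 \<le> c\<^sup>2 * pf_denominator G x y"
  shows "p_fun G x y \<le> c * s_metric G x y"
proof (cases "x = y")
  case False
  have "detour G x y \<le> sqrt (c\<^sup>2 * pf_denominator G x y)"
    using assms(3) by (rule real_le_rsqrt)
  also have "\<dots> = c * sqrt (pf_denominator G x y)"
    using assms(2) by (simp add: real_sqrt_mult)
  finally show ?thesis
    unfolding s_metric_detour p_fun_pf_denominator
    using denominators_pos[OF False, of G] detour_pos[OF assms(1) False] by (intro divide_le_scaled) auto
qed (simp add: s_metric_def p_fun_def)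

section \<open>Sharpness through pairs attaining the bounds\<close>

text \<open>A single pair attaining the bound suffices: since \<open>g x y\<close> is positive
  there, every smaller constant fails at that pair.\<close>

lemma sharp_upperI:
  assumes "x \<in> G" "y \<in> G" "x \<noteq> y" "0 < g x y" "c * g x y \<le> f x y"
  shows "sharp_upper G f c g"
  unfolding sharp_upper_def
proof (intro allI impI)
  fix c' assume "c' < c"
  then have "c' * g x y < f x y"
    using mult_strict_right_mono[OF _ assms(4), of c' c] assms(5) by linarith
  then show "\<exists>x\<in>G. \<exists>y\<in>G. x \<noteq> y \<and> c' * g x y < f x y"
    using assms by (intro bexI[of _ x] bexI[of _ y]) auto
qed

lemma sharp_lowerI:
  assumes "x \<in> G" "y \<in> G" "x \<noteq> y" "0 < g x y" "f x y \<le> c * g x y"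
  shows "sharp_lower G c g f"
  unfolding sharp_lower_def
proof (intro allI impI)
  fix c' assume "c < c'"
  then have "f x y < c' * g x y"
    using mult_strict_right_mono[OF _ assms(4), of c c'] assms(5) by linarith
  then show "\<exists>x\<in>G. \<exists>y\<in>G. x \<noteq> y \<and> f x y < c' * g x y"
    using assms by (intro bexI[of _ x] bexI[of _ y]) auto
qed

text \<open>Links the constants of the theorem to the factors in the squared comparisons.\<close>

lemma cos_quarter_squared: "(sqrt 2 * cos (\<theta> / 4))\<^sup>2 = 1 + cos (\<theta> / 2)"
  using cos_double_cos[of "\<theta> / 4"] by (simp add: power_mult_distrib)

lemma sin_quarter_squared: "(sqrt 2 * sin (\<theta> / 4))\<^sup>2 = 1 - cos (\<theta> / 2)"
  using cos_double_sin[of "\<theta> / 4"] by (simp add: power_mult_distrib)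

lemma frontier_sector_nonempty: "0 < \<theta> \<Longrightarrow> \<theta> < 2 * pi \<Longrightarrow> frontier (sector \<theta>) \<noteq> {}"
  using zero_in_rays[of \<theta>] by (auto simp: frontier_sector)

text \<open>On this pair, symmetric about the bisector, the upper constants of (1), (3) and (5) and
  the lower constant of (4) are attained.\<close>

lemma quarter_points:
  assumes "0 < \<theta>" "\<theta> < 2 * pi"
  defines "x \<equiv> rcis 1 (\<theta> / 4)" and "y \<equiv> rcis 1 (3 * \<theta> / 4)" and "d \<equiv> sin (\<theta> / 4)"
  shows "x \<in> sector \<theta>" "y \<in> sector \<theta>" "x \<noteq> y" "0 < d" "dist x y = 2 * d"
    "dist x y + 2 * min (bdist (sector \<theta>) x) (bdist (sector \<theta>) y) = 4 * d"
    "sqrt (pf_denominator (sector \<theta>) x y) = sqrt 2 * (2 * d)"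
proof -
  show S: "x \<in> sector \<theta>" "y \<in> sector \<theta>"
    unfolding x_def y_def using assms(1,2) by (auto intro!: rcis_in_sector)
  show d: "0 < d"
    unfolding d_def using assms(1,2) by (intro sin_gt_zero) auto
  have depth: "sector_depth \<theta> (\<theta> / 4) = d" "sector_depth \<theta> (3 * \<theta> / 4) = d"
    unfolding sector_depth_def d_def using assms(1,2)
    by (auto simp: min_def field_simps intro!: arg_cong[of _ _ sin])
  then have b: "bdist (sector \<theta>) x = d" "bdist (sector \<theta>) y = d"
    unfolding x_def y_def using assms(1,2) by (simp_all add: bdist_sector)
  \<comment> \<open>The half-difference of the arguments is again \<theta>/4, so |x - y| is twice
    the common boundary distance, the equality case of
    \<open>square_le_pf_denominator\<close>.\<close>
  have "(dist x y)\<^sup>2 = (2 * d)\<^sup>2"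
    unfolding x_def y_def d_def dist_rcis_half_angle by (simp add: power_mult_distrib)
  then show t: "dist x y = 2 * d"
    by (rule power2_eq_imp_eq) (use d in auto)
  then show "x \<noteq> y" using d by auto
  show "dist x y + 2 * min (bdist (sector \<theta>) x) (bdist (sector \<theta>) y) = 4 * d"
    by (simp add: t b)
  have "pf_denominator (sector \<theta>) x y = 2 * (2 * d)\<^sup>2"
    unfolding pf_denominator_def t b by (simp add: power2_eq_square)
  then show "sqrt (pf_denominator (sector \<theta>) x y) = sqrt 2 * (2 * d)"
    using d by (simp only: real_sqrt_mult real_sqrt_abs)
qed

lemma sharp_p_fun_j_star_upper:
  assumes "0 < \<theta>" "\<theta> < 2 * pi"
  shows "sharp_upper (sector \<theta>) (p_fun (sector \<theta>)) (sqrt 2) (j_star (sector \<theta>))"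
proof -
  note q = quarter_points[OF assms]
  show ?thesis
  proof (rule sharp_upperI[OF q(1-3)])
    show "sqrt 2 * j_star (sector \<theta>) (rcis 1 (\<theta> / 4)) (rcis 1 (3 * \<theta> / 4))
      \<le> p_fun (sector \<theta>) (rcis 1 (\<theta> / 4)) (rcis 1 (3 * \<theta> / 4))"
      unfolding j_star_def p_fun_pf_denominator q(6,7) using q(4) by (intro scaled_le_divide) auto
  qed (rule j_star_pos[OF q(3)])
qed

text \<open>Reflection in either ray gives the same length 2 sin(\<theta>/2) = 4 sin(\<theta>/4)
  cos(\<theta>/4), a lower bound for every detour. Divided by the \<open>p_fun\<close> denominator 2
  sqrt 2 sin(\<theta>/4) it becomes sqrt 2 cos(\<theta>/4).\<close>

lemma sharp_s_metric_p_fun_lower: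
  assumes "0 < \<theta>" "\<theta> \<le> pi"
  shows "sharp_lower (sector \<theta>) (inverse (sqrt 2 * cos (\<theta> / 4))) (p_fun (sector \<theta>)) (s_metric (sector \<theta>))"
proof -
  have \<theta>: "\<theta> < 2 * pi" using assms by linarith
  note q = quarter_points[OF assms(1) \<theta>]
  have c: "0 < cos (\<theta> / 4)" using assms by (intro cos_gt_zero_pi) auto
  have detour: "2 * sin (\<theta> / 2) \<le> detour (sector \<theta>) (rcis 1 (\<theta> / 4)) (rcis 1 (3 * \<theta> / 4))"
  proof (rule detour_ge)
    fix z assume "z \<in> frontier (sector \<theta>)"
    then obtain r \<gamma> where z: "z = rcis r \<gamma>" "\<gamma> = 0 \<or> \<gamma> = \<theta>"
      using assms \<theta> by (auto simp: frontier_sector rays_def)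
    have "(3 * \<theta> / 4 - (2 * \<gamma> - \<theta> / 4)) / 2 = \<theta> / 2
        \<or> (3 * \<theta> / 4 - (2 * \<gamma> - \<theta> / 4)) / 2 = - (\<theta> / 2)"
      using z(2) by auto
    then have half: "(sin ((3 * \<theta> / 4 - (2 * \<gamma> - \<theta> / 4)) / 2))\<^sup>2 = (sin (\<theta> / 2))\<^sup>2"
      by (elim disjE) (simp_all only: sin_minus power2_minus)
    have "(2 * sin (\<theta> / 2))\<^sup>2 = (dist (rcis 1 (2 * \<gamma> - \<theta> / 4)) (rcis 1 (3 * \<theta> / 4)))\<^sup>2"
      unfolding dist_rcis_half_angle half by (simp add: power_mult_distrib)
    then have "2 * sin (\<theta> / 2) \<le> dist (rcis 1 (2 * \<gamma> - \<theta> / 4)) (rcis 1 (3 * \<theta> / 4))"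
      by (rule power2_le_imp_le[OF eq_refl]) simp
    also have "\<dots> \<le> dist (rcis 1 (\<theta> / 4)) z + dist z (rcis 1 (3 * \<theta> / 4))"
      unfolding z(1) by (rule reflected_dist_le)
    finally show "2 * sin (\<theta> / 2) \<le> dist (rcis 1 (\<theta> / 4)) z + dist z (rcis 1 (3 * \<theta> / 4))" .
  qed (rule frontier_sector_nonempty[OF assms(1) \<theta>])
  moreover have "sin (\<theta> / 2) = 2 * sin (\<theta> / 4) * cos (\<theta> / 4)"
    using sin_double[of "\<theta> / 4"] by simp
  ultimately have "inverse (sqrt 2 * cos (\<theta> / 4)) * (4 * sin (\<theta> / 4) * cos (\<theta> / 4))
      \<le> inverse (sqrt 2 * cos (\<theta> / 4)) * detour (sector \<theta>) (rcis 1 (\<theta> / 4)) (rcis 1 (3 * \<theta> / 4))"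
    using c by (intro mult_left_mono) auto
  moreover have "inverse (sqrt 2 * cos (\<theta> / 4)) * (4 * sin (\<theta> / 4) * cos (\<theta> / 4)) = sqrt 2 * (2 * sin (\<theta> / 4))"
    using c by (simp add: field_simps)
  ultimately have le: "sqrt 2 * (2 * sin (\<theta> / 4))
      \<le> inverse (sqrt 2 * cos (\<theta> / 4)) * detour (sector \<theta>) (rcis 1 (\<theta> / 4)) (rcis 1 (3 * \<theta> / 4))"
    by (simp only:)
  show ?thesis
  proof (rule sharp_lowerI[OF q(1-3)])
    show "s_metric (sector \<theta>) (rcis 1 (\<theta> / 4)) (rcis 1 (3 * \<theta> / 4))
      \<le> inverse (sqrt 2 * cos (\<theta> / 4)) * p_fun (sector \<theta>) (rcis 1 (\<theta> / 4)) (rcis 1 (3 * \<theta> / 4))"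
      unfolding s_metric_detour p_fun_pf_denominator q(7)
      using q(4) le detour_pos[OF frontier_sector_nonempty[OF assms(1) \<theta>] q(3)]
      by (intro divide_le_scaled) auto
  qed (rule p_fun_pos[OF q(3)])
qed

text \<open>The vertex gives a detour of length 2, while the denominators of \<open>j_star\<close>
  and \<open>p_fun\<close> are 4 sin(\<theta>/4) and 2 sqrt 2 sin(\<theta>/4); the quotients are the
  two constants.\<close>

lemma sharp_s_metric_upper_nonconvex:
  assumes "0 < \<theta>" "\<theta> < 2 * pi"
  shows "sharp_upper (sector \<theta>) (s_metric (sector \<theta>)) (2 * sin (\<theta> / 4)) (j_star (sector \<theta>))"
    and "sharp_upper (sector \<theta>) (s_metric (sector \<theta>)) (sqrt 2 * sin (\<theta> / 4)) (p_fun (sector \<theta>))"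
proof -
  note q = quarter_points[OF assms]
  have L: "0 < detour (sector \<theta>) (rcis 1 (\<theta> / 4)) (rcis 1 (3 * \<theta> / 4))"
    by (rule detour_pos[OF frontier_sector_nonempty[OF assms] q(3)])
  have "detour (sector \<theta>) (rcis 1 (\<theta> / 4)) (rcis 1 (3 * \<theta> / 4)) \<le> 2"
    using detour_le_add[OF assms, of 1 1 "\<theta> / 4" "3 * \<theta> / 4"] by simp
  then have le: "sin (\<theta> / 4) * detour (sector \<theta>) (rcis 1 (\<theta> / 4)) (rcis 1 (3 * \<theta> / 4)) \<le> sin (\<theta> / 4) * 2"
    using q(4) by (intro mult_left_mono) auto
  show "sharp_upper (sector \<theta>) (s_metric (sector \<theta>)) (2 * sin (\<theta> / 4)) (j_star (sector \<theta>))"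
  proof (rule sharp_upperI[OF q(1-3)])
    show "2 * sin (\<theta> / 4) * j_star (sector \<theta>) (rcis 1 (\<theta> / 4)) (rcis 1 (3 * \<theta> / 4))
      \<le> s_metric (sector \<theta>) (rcis 1 (\<theta> / 4)) (rcis 1 (3 * \<theta> / 4))"
      unfolding j_star_def s_metric_detour q(6) using q(4) L le by (intro scaled_le_divide) auto
  qed (rule j_star_pos[OF q(3)])
  show "sharp_upper (sector \<theta>) (s_metric (sector \<theta>)) (sqrt 2 * sin (\<theta> / 4)) (p_fun (sector \<theta>))"
  proof (rule sharp_upperI[OF q(1-3)])
    show "sqrt 2 * sin (\<theta> / 4) * p_fun (sector \<theta>) (rcis 1 (\<theta> / 4)) (rcis 1 (3 * \<theta> / 4))
      \<le> s_metric (sector \<theta>) (rcis 1 (\<theta> / 4)) (rcis 1 (3 * \<theta> / 4))"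
      unfolding p_fun_pf_denominator s_metric_detour q(7) using q(4) L le
      by (intro scaled_le_divide) auto
  qed (rule p_fun_pos[OF q(3)])
qed

text \<open>At an acute argument not beyond the bisector, the nearest boundary point is the vertical
  projection to the real axis. Cartesian coordinates make horizontal and vertical distances between
  such points immediate.\<close>

lemma low_point:
  assumes "0 < \<phi>" "\<phi> \<le> \<theta> / 2" "\<phi> < pi / 2" "\<theta> < 2 * pi" "0 < r"
  shows "Complex r (r * tan \<phi>) \<in> sector \<theta>" "bdist (sector \<theta>) (Complex r (r * tan \<phi>)) = r * tan \<phi>"
proof -
  have c: "0 < cos \<phi>" using assms by (intro cos_gt_zero_pi) auto
  then have eq: "Complex r (r * tan \<phi>) = rcis (r / cos \<phi>) \<phi>"
    by (simp add: complex_eq_iff tan_def)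
  show "Complex r (r * tan \<phi>) \<in> sector \<theta>"
    unfolding eq using assms c by (intro rcis_in_sector) auto
  have "sector_depth \<theta> \<phi> = sin \<phi>"
    using assms by (auto simp: sector_depth_def min_def intro!: arg_cong[of _ _ sin])
  then show "bdist (sector \<theta>) (Complex r (r * tan \<phi>)) = r * tan \<phi>"
    unfolding eq using assms c by (subst bdist_sector) (auto simp: tan_def)
qed

text \<open>Here y lies above x on a perpendicular to the boundary, so that its boundary distance exceeds
  that of x by exactly the distance of the two points.\<close>

lemma p_fun_le_j_star_attained:
  assumes "0 < \<theta>" "\<theta> < 2 * pi"
  obtains x y where "x \<in> sector \<theta>" "y \<in> sector \<theta>" "x \<noteq> y"
    "p_fun (sector \<theta>) x y \<le> j_star (sector \<theta>) x y"
proof -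
  \<comment> \<open>The heights at which the vertical line through 1 reaches the arguments
    \<theta>/8 and \<theta>/4, both within reach of \<open>low_point\<close>.\<close>
  define u v where "u = tan (\<theta> / 8)" and "v = tan (\<theta> / 4)"
  have uv: "0 < u" "u < v"
    unfolding u_def v_def using assms by (auto intro!: tan_gt_zero tan_monotone)
  define x y where "x = Complex 1 u" and "y = Complex 1 v"
  have x: "x \<in> sector \<theta>" "bdist (sector \<theta>) x = u"
    unfolding x_def u_def using assms low_point[of "\<theta> / 8" \<theta> 1] by auto
  have y: "y \<in> sector \<theta>" "bdist (sector \<theta>) y = v"
    unfolding y_def v_def using assms low_point[of "\<theta> / 4" \<theta> 1] by auto
  have t: "dist x y = v - u"
    unfolding dist_norm x_def y_def cmod_def using uv by (simp add: power2_commute)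
  have "pf_denominator (sector \<theta>) x y = (v + u)\<^sup>2"
    unfolding pf_denominator_def t x y by (simp add: power2_eq_square algebra_simps)
  then have "p_fun (sector \<theta>) x y \<le> j_star (sector \<theta>) x y"
    unfolding p_fun_pf_denominator j_star_def using uv by (simp add: t x y add.commute)
  moreover have "x \<noteq> y" using uv by (simp add: x_def y_def)
  ultimately show thesis using that x y by blast
qed

text \<open>On the bisector the vertex is a nearest boundary point, so for moduli 1 and 2 every
  detour has length at least 1 + 2, and the denominators of \<open>j_star\<close> and
  \<open>p_fun\<close> both equal 3.\<close>

lemma nonconvex_bisector_points:
  assumes "pi < \<theta>" "\<theta> < 2 * pi"
  obtains x y where "x \<in> sector \<theta>" "y \<in> sector \<theta>" "x \<noteq> y"
    "s_metric (sector \<theta>) x y \<le> j_star (sector \<theta>) x y" "s_metric (sector \<theta>) x y \<le> p_fun (sector \<theta>) x y"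
proof -
  have "0 < \<theta>" using assms pi_gt_zero by linarith
  define x y where "x = rcis 1 (\<theta> / 2)" and "y = rcis 2 (\<theta> / 2)"
  have S: "x \<in> sector \<theta>" "y \<in> sector \<theta>"
    unfolding x_def y_def using assms \<open>0 < \<theta>\<close> by (auto intro!: rcis_in_sector)
  have "sector_depth \<theta> (\<theta> / 2) = 1"
    unfolding sector_depth_def using assms by (simp add: min_def)
  then have b: "bdist (sector \<theta>) x = 1" "bdist (sector \<theta>) y = 2"
    unfolding x_def y_def using assms \<open>0 < \<theta>\<close> by (simp_all add: bdist_sector)
  have "(dist x y)\<^sup>2 = 1\<^sup>2"
    unfolding x_def y_def dist_rcis_half_angle by simp
  then have t: "dist x y = 1"
    by (simp only: power2_eq_iff_nonneg zero_le_dist zero_le_one)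
  then have "x \<noteq> y" by auto
  have "3 \<le> detour (sector \<theta>) x y"
  proof (rule detour_ge)
    fix z assume "z \<in> frontier (sector \<theta>)"
    then show "3 \<le> dist x z + dist z y"
      using infdist_le[of z "frontier (sector \<theta>)" x] infdist_le[of z "frontier (sector \<theta>)" y] b
      by (simp add: bdist_def dist_commute)
  qed (rule frontier_sector_nonempty[OF \<open>0 < \<theta>\<close> assms(2)])
  then have "s_metric (sector \<theta>) x y \<le> 1 / 3"
    unfolding s_metric_detour t by (intro divide_left_mono) auto
  moreover have "j_star (sector \<theta>) x y = 1 / 3"
    by (simp add: j_star_def t b)
  moreover have "sqrt 9 = sqrt (3\<^sup>2)" by simp
  then have "p_fun (sector \<theta>) x y = 1 / 3"
    unfolding p_fun_def t b by simp
  ultimately show thesis using that S \<open>x \<noteq> y\<close> by simp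
qed

text \<open>Two points at height h and distance 2h: from the boundary point midway below, both are
  seen at 45 degrees, so the detour is at most 2 sqrt 2 h. This equals the denominator of
  \<open>p_fun\<close>, and that of \<open>j_star\<close> is 4h.\<close>

lemma convex_horizontal_points:
  assumes "0 < \<theta>" "\<theta> \<le> pi"
  obtains x y where "x \<in> sector \<theta>" "y \<in> sector \<theta>" "x \<noteq> y"
    "sqrt 2 * j_star (sector \<theta>) x y \<le> s_metric (sector \<theta>) x y" "p_fun (sector \<theta>) x y \<le> s_metric (sector \<theta>) x y"
proof -
  have \<theta>: "\<theta> < 2 * pi" using assms by linarith
  define h where "h = tan (\<theta> / 4)"
  \<comment> \<open>The argument of \<open>y\<close>; it is below \<theta>/4, so
    \<open>low_point\<close> applies.\<close>
  define \<beta> where "\<beta> = arctan (h / (1 + 2 * h))"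
  define x y where "x = Complex 1 h" and "y = Complex (1 + 2 * h) h"
  have h: "0 < h"
    unfolding h_def using assms by (intro tan_gt_zero) auto
  have "h / (1 + 2 * h) < h"
    using h by (simp add: field_simps)
  then have "arctan (h / (1 + 2 * h)) < arctan h"
    by (rule arctan_monotone)
  also have "arctan h = \<theta> / 4"
    unfolding h_def using assms by (intro arctan_tan) auto
  finally have \<beta>: "0 < \<beta>" "\<beta> < \<theta> / 4"
    using h by (simp_all add: \<beta>_def)
  have "(1 + 2 * h) * tan \<beta> = h"
    using h by (simp add: \<beta>_def tan_arctan)
  then have y: "y \<in> sector \<theta>" "bdist (sector \<theta>) y = h"
    unfolding y_def using low_point[of \<beta> \<theta> "1 + 2 * h"] \<beta> assms \<theta> h by auto
  have x: "x \<in> sector \<theta>" "bdist (sector \<theta>) x = h"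
    unfolding x_def h_def using low_point[of "\<theta> / 4" \<theta> 1] assms \<theta> by auto
  have t: "dist x y = 2 * h"
    unfolding dist_norm x_def y_def cmod_def using h real_sqrt_abs[of "2 * h"] by simp
  then have xy: "x \<noteq> y" using h by auto
  have "sqrt (h\<^sup>2 + h\<^sup>2) = sqrt (2 * h\<^sup>2)" by simp
  also have "\<dots> = sqrt 2 * h" using h by (simp only: real_sqrt_mult real_sqrt_abs abs_of_pos)
  finally have d: "dist x (rcis (1 + h) 0) = sqrt 2 * h" "dist (rcis (1 + h) 0) y = sqrt 2 * h"
    unfolding dist_norm x_def y_def cmod_def by simp_all
  have "rcis (1 + h) 0 \<in> frontier (sector \<theta>)"
    unfolding frontier_sector[OF assms(1) \<theta>] using h by (intro rcis_in_rays) simp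
  from detour_le[OF this, of x y] have L: "detour (sector \<theta>) x y \<le> sqrt 2 * (2 * h)"
    unfolding d by (simp add: ac_simps)
  have L0: "0 < detour (sector \<theta>) x y"
    by (rule detour_pos[OF frontier_sector_nonempty[OF assms(1) \<theta>] xy])
  have "pf_denominator (sector \<theta>) x y = 2 * (2 * h)\<^sup>2"
    unfolding pf_denominator_def t x y by (simp add: power2_eq_square)
  then have T: "sqrt (pf_denominator (sector \<theta>) x y) = sqrt 2 * (2 * h)"
    using h by (simp only: real_sqrt_mult real_sqrt_abs)
  have "p_fun (sector \<theta>) x y \<le> s_metric (sector \<theta>) x y"
    unfolding p_fun_pf_denominator s_metric_detour T using L L0 h by (intro divide_left_mono) auto
  moreover have "sqrt 2 * detour (sector \<theta>) x y \<le> 4 * h"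
    using mult_left_mono[OF L, of "sqrt 2"] by (simp only: real_sqrt_ge_0_iff mult.assoc[symmetric] real_sqrt_mult_self) simp
  then have "sqrt 2 * j_star (sector \<theta>) x y \<le> s_metric (sector \<theta>) x y"
    unfolding j_star_def s_metric_detour t x y using L0 h by (intro scaled_le_divide) auto
  ultimately show thesis using that x y xy by blast
qed

theorem theorem3p11:
  fixes \<theta> :: real
  assumes "0 < \<theta>" and "\<theta> < 2 * pi"
  defines "S \<equiv> sector \<theta>"
  shows
   "(\<forall>x\<in>S. \<forall>y\<in>S. j_star S x y \<le> p_fun S x y \<and> p_fun S x y \<le> sqrt 2 * j_star S x y)
    \<and> sharp_lower S 1 (j_star S) (p_fun S) \<and> sharp_upper S (p_fun S) (sqrt 2) (j_star S)
    \<and> (\<theta> \<le> pi \<longrightarrow>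
        (\<forall>x\<in>S. \<forall>y\<in>S. j_star S x y \<le> s_metric S x y \<and> s_metric S x y \<le> sqrt 2 * j_star S x y)
        \<and> sharp_lower S 1 (j_star S) (s_metric S) \<and> sharp_upper S (s_metric S) (sqrt 2) (j_star S))
    \<and> (pi < \<theta> \<longrightarrow>
        (\<forall>x\<in>S. \<forall>y\<in>S. j_star S x y \<le> s_metric S x y
              \<and> s_metric S x y \<le> 2 * sin (\<theta> / 4) * j_star S x y)
        \<and> sharp_lower S 1 (j_star S) (s_metric S)
        \<and> sharp_upper S (s_metric S) (2 * sin (\<theta> / 4)) (j_star S))
    \<and> (\<theta> \<le> pi \<longrightarrow>
        (\<forall>x\<in>S. \<forall>y\<in>S. inverse (sqrt 2 * cos (\<theta> / 4)) * p_fun S x y \<le> s_metric S x y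
              \<and> s_metric S x y \<le> p_fun S x y)
        \<and> sharp_lower S (inverse (sqrt 2 * cos (\<theta> / 4))) (p_fun S) (s_metric S)
        \<and> sharp_upper S (s_metric S) 1 (p_fun S))
    \<and> (pi < \<theta> \<longrightarrow>
        (\<forall>x\<in>S. \<forall>y\<in>S. p_fun S x y \<le> s_metric S x y
              \<and> s_metric S x y \<le> sqrt 2 * sin (\<theta> / 4) * p_fun S x y)
        \<and> sharp_lower S 1 (p_fun S) (s_metric S)
        \<and> sharp_upper S (s_metric S) (sqrt 2 * sin (\<theta> / 4)) (p_fun S))"
proof -
  have ne: "frontier S \<noteq> {}"
    unfolding S_def by (rule frontier_sector_nonempty[OF assms(1,2)])
  have s_le_p: "s_metric S x y \<le> p_fun S x y" if "\<theta> \<le> pi" "x \<in> S" "y \<in> S" for x y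
    using s_metric_le_p_fun[OF ne, of 1 x y] convex_pf_le_detour[of \<theta> x y] that by (simp add: S_def)
  have p_le_s: "inverse (sqrt 2 * cos (\<theta> / 4)) * p_fun S x y \<le> s_metric S x y"
    if "\<theta> \<le> pi" "x \<in> S" "y \<in> S" for x y
  proof -
    have c: "0 < sqrt 2 * cos (\<theta> / 4)"
      using assms that(1) by (intro mult_pos_pos cos_gt_zero_pi) auto
    then have "p_fun S x y \<le> sqrt 2 * cos (\<theta> / 4) * s_metric S x y"
      using ne that convex_detour_le_pf[of \<theta> x y]
      by (intro p_fun_le_s_metric) (auto simp only: S_def cos_quarter_squared)
    then show ?thesis
      using c by (simp only: inverse_eq_divide) (simp add: field_simps)
  qed
  have p_le_s': "p_fun S x y \<le> s_metric S x y" if "pi < \<theta>" "x \<in> S" "y \<in> S" for x y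
    using p_fun_le_s_metric[OF ne, of 1 x y] nonconvex_detour_le_pf[of \<theta> x y] that assms(2)
    by (simp add: S_def)
  have s0: "0 < sin (\<theta> / 4)"
    using assms by (intro sin_gt_zero) auto
  have s_le_p': "s_metric S x y \<le> sqrt 2 * sin (\<theta> / 4) * p_fun S x y" if "pi < \<theta>" "x \<in> S" "y \<in> S" for x y
    using ne that nonconvex_pf_le_detour[of \<theta> x y] assms(2) s0
    by (intro s_metric_le_p_fun) (auto simp: S_def sin_quarter_squared simp del: power_mult_distrib)
  have s_le_j: "s_metric S x y \<le> 2 * sin (\<theta> / 4) * j_star S x y" if "pi < \<theta>" "x \<in> S" "y \<in> S" for x y
  proof -
    have "sqrt 2 * sin (\<theta> / 4) * p_fun S x y \<le> sqrt 2 * sin (\<theta> / 4) * (sqrt 2 * j_star S x y)"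
      using s0 by (intro mult_left_mono p_fun_le_j_star) auto
    also have "\<dots> = (sqrt 2 * sqrt 2) * sin (\<theta> / 4) * j_star S x y"
      by (simp only: mult_ac)
    finally show ?thesis
      using s_le_p'[OF that] by simp
  qed
  have s_le_j': "s_metric S x y \<le> sqrt 2 * j_star S x y" if "\<theta> \<le> pi" "x \<in> S" "y \<in> S" for x y
    using s_le_p[OF that] p_fun_le_j_star order_trans by blast
  have low_jp: "sharp_lower S 1 (j_star S) (p_fun S)"
    and low_js: "\<theta> \<le> pi \<Longrightarrow> sharp_lower S 1 (j_star S) (s_metric S)"
  proof -
    obtain x y where xy: "x \<in> S" "y \<in> S" "x \<noteq> y" "p_fun S x y \<le> j_star S x y"
      unfolding S_def using p_fun_le_j_star_attained[OF assms(1,2)] .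
    then show "sharp_lower S 1 (j_star S) (p_fun S)"
      by (intro sharp_lowerI[of x S y]) (auto intro: j_star_pos)
    \<comment> \<open>The same pair serves here, since \<open>s_metric\<close> is at most
      \<open>p_fun\<close> in the convex case.\<close>
    show "sharp_lower S 1 (j_star S) (s_metric S)" if "\<theta> \<le> pi"
      using xy s_le_p[OF that xy(1,2)] by (intro sharp_lowerI[of x S y]) (auto intro: j_star_pos)
  qed
  have low_nonconvex: "sharp_lower S 1 (j_star S) (s_metric S)" "sharp_lower S 1 (p_fun S) (s_metric S)"
    if pi: "pi < \<theta>"
  proof -
    obtain x y where "x \<in> S" "y \<in> S" "x \<noteq> y" "s_metric S x y \<le> j_star S x y"
      "s_metric S x y \<le> p_fun S x y"
      unfolding S_def using nonconvex_bisector_points[OF pi assms(2)] .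
    then show "sharp_lower S 1 (j_star S) (s_metric S)" "sharp_lower S 1 (p_fun S) (s_metric S)"
      by (auto intro!: sharp_lowerI[of x S y] intro: j_star_pos p_fun_pos)
  qed
  have up_convex: "sharp_upper S (s_metric S) (sqrt 2) (j_star S)" "sharp_upper S (s_metric S) 1 (p_fun S)"
    if pi: "\<theta> \<le> pi"
  proof -
    obtain x y where "x \<in> S" "y \<in> S" "x \<noteq> y" "sqrt 2 * j_star S x y \<le> s_metric S x y"
      "p_fun S x y \<le> s_metric S x y"
      unfolding S_def using convex_horizontal_points[OF assms(1) pi] .
    then show "sharp_upper S (s_metric S) (sqrt 2) (j_star S)" "sharp_upper S (s_metric S) 1 (p_fun S)"
      by (auto intro!: sharp_upperI[of x S y] intro: j_star_pos p_fun_pos)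
  qed
  have up_nonconvex: "sharp_upper S (s_metric S) (2 * sin (\<theta> / 4)) (j_star S)"
      "sharp_upper S (s_metric S) (sqrt 2 * sin (\<theta> / 4)) (p_fun S)"
    unfolding S_def by (rule sharp_s_metric_upper_nonconvex[OF assms(1,2)])+
  have up_pj: "sharp_upper S (p_fun S) (sqrt 2) (j_star S)"
    unfolding S_def by (rule sharp_p_fun_j_star_upper[OF assms(1,2)])
  have low_sp: "sharp_lower S (inverse (sqrt 2 * cos (\<theta> / 4))) (p_fun S) (s_metric S)" if "\<theta> \<le> pi"
    unfolding S_def by (rule sharp_s_metric_p_fun_lower[OF assms(1) that])
  show ?thesis
    by (intro conjI impI ballI j_star_le_p_fun p_fun_le_j_star j_star_le_s_metric[OF ne]
        s_le_p p_le_s p_le_s' s_le_p' s_le_j s_le_j' low_jp low_js low_nonconvex up_convex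
        up_nonconvex up_pj low_sp)
qed

end
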